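(* Let $q,r\in\mathbb{C}\setminus\{0\}$ with $q^k\neq 1$ for all positive integers $k$ and $r\neq \pm q^k$ for all $k\in\mathbb{Z}$. For any $n\geq 3$, the symmetrizer $S_n$ of $\mathrm{BWM}(r,q)_n$ satisfies $$S_n=\frac{S_{n-1}\,b^+_{n-1,1}}{q^{n-1}[\![n]\!]}=\frac{S_{n-1}[1]\,b^+_{1,n-1}}{q^{n-1}[\![n]\!]}=\frac{a^+_{n-1,1}\,S_{n-1}}{q^{n-1}[\![n]\!]}=\frac{a^+_{1,n-1}\,S_{n-1}[1]}{q^{n-1}[\![n]\!]}.$$
   Context: Let $q,r\in\mathbb{C}\setminus\{0\}$ with $q^k\neq1$ for all positive integers $k$ and $r\neq\pm q^k$ for all $k\in\mathbb{Z}$. Put $\hat q:=q-q^{-1}$ and $[\![k]\!]:=(q^k-q^{-k})/(q-q^{-1})$ for $k\in\mathbb{Z}$. For $n\ge 2$, the Birman--Wenzl--Murakami algebra $\mathrm{BWM}(r,q)_n$ is the unital $\mathbb{C}$-algebra generated by $g_i,e_i$, $i=1,\dots,n-1$, with relations (for all indices for which they make sense) $$g_ig_{i+1}g_i=g_{i+1}g_ig_{i+1},\qquad g_ig_j=g_jg_i\ \text{ for } |i-j|>1,$$ $$g_i^2=1+\hat q g_i-r^{-1}\hat q e_i,\qquad g_ie_i=e_ig_i=r^{-1}e_i,$$ $$g_ig_{i+1}e_i=e_{i+1}e_i,\qquad g_{i+1}g_ie_{i+1}=e_ie_{i+1}.$$ The algebra $\mathrm{BWM}(r,q)_{n}$ is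 naturally embedded into $\mathrm{BWM}(r,q)_{n+k}$, $k\ge0$, via $g_i\mapsto g_i$, $e_i\mapsto e_i$. Let $s:\mathrm{BWM}(r,q)_{n-1}\to\mathrm{BWM}(r,q)_{n}$ be the shift homomorphism $s(g_i)=g_{i+1}$, $s(e_i)=e_{i+1}$; write $b[1]:=s(b)$, so $S_{n-1}[1]=s(S_{n-1})$. The symmetrizer $S_n$ ($n\ge 2$) is the unique nonzero element of $\mathrm{BWM}(r,q)_n$ such that $S_n^2=S_n$ and $S_ng_i=qS_n$ for all $i=1,\dots,n-1$ (its existence and uniqueness are known); it is central. For $1\le i<k$ define $$d^+_{k,i}:=e_{k-1}e_{k-2}\cdots e_i\sum_{j=0}^{i-1}q^j\, g_{i-1}g_{i-2}\cdots g_{i-j},$$ $$d'^{+}_{k,i}:=e_1e_2\cdots e_{k-i}\sum_{j=0}^{i-1}q^j\,g_{k+1-i}g_{k+2-i}\cdots g_{k-i+j},$$ $$\bar d^{+}_{k,i}:=\sum_{j=0}^{i-1}q^j\,g_{i-j}\cdots g_{i-2}g_{i-1}\,e_ie_{i+1}\cdots e_{k-1},$$ $$\bar d'^{+}_{k,i}:=\sum_{j=0}^{i-1}q^j\,g_{k-i+j}\cdots g_{k-i+2}g_{k-i+1}\,e_{k-i}\cdots e_2e_1,$$ and for $0\le k<n$ define $$b^+_{k,1}:=\sum_{i=0}^kq^i\,g_kg_{k-1}\cdots g_{k+1-i}+\frac{\hat q}{1-q^{2k-1}r}\sum_{i=1}^kq^{2k-2i+1}d^+_{k+1,i},$$ $$b^+_{1,k}:=\sum_{i=0}^kq^i\,g_1g_2\cdots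 g_i+\frac{\hat q}{1-q^{2k-1}r}\sum_{i=1}^kq^{2k-2i+1}d'^{+}_{k+1,i},$$ $$a^+_{k,1}:=\sum_{i=0}^kq^i\,g_{k+1-i}\cdots g_{k-1}g_k+\frac{\hat q}{1-q^{2k-1}r}\sum_{i=1}^kq^{2k-2i+1}\bar d^{+}_{k+1,i},$$ $$a^+_{1,k}:=\sum_{i=0}^kq^i\,g_i\cdots g_2g_1+\frac{\hat q}{1-q^{2k-1}r}\sum_{i=1}^kq^{2k-2i+1}\bar d'^{+}_{k+1,i}.$$ In the inner sums over $j$ (in the definitions of the $d$'s) the product of $g$'s has $j$ factors; in the sums over $i$ with coefficient $q^i$ the product of $g$'s has $i$ factors; empty products equal $1$. *)

theory Defs
  imports Complex_Main "HOL-Library.Poly_Mapping" "HOL-Algebra.QuotRing"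
begin

datatype (gen_indices: 'i) bwm_gen = G 'i | E 'i

datatype bwm_word = Word (letters: "nat bwm_gen list")

text \<open>Words form the free monoid under concatenation, written additively because the convolution
  product of \<^typ>\<open>'a \<Rightarrow>\<^sub>0 'b\<close> is defined for an additive index monoid.
  Hence \<open>bwm_word \<Rightarrow>\<^sub>0 complex\<close> is the algebra of noncommutative polynomials.\<close>

instantiation bwm_word :: monoid_add
begin
definition zero_bwm_word where "0 = Word []"
definition plus_bwm_word where "u + v = Word (letters u @ letters v)"
instance
  by standard (simp_all add: zero_bwm_word_def plus_bwm_word_def)
end

type_synonym ncpoly = "bwm_word \<Rightarrow>\<^sub>0 complex"

definition const :: "complex \<Rightarrow> ncpoly" where
  "const c = Poly_Mapping.single 0 c"

definition g :: "nat \<Rightarrow> ncpoly" where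
  "g i = Poly_Mapping.single (Word [G i]) 1"

definition e :: "nat \<Rightarrow> ncpoly" where
  "e i = Poly_Mapping.single (Word [E i]) 1"

definition free_alg :: "nat \<Rightarrow> ncpoly ring" where
  "free_alg n =
    \<lparr>carrier = {p. \<forall>w\<in>Poly_Mapping.keys p. \<forall>x\<in>set (letters w). gen_indices x \<subseteq> {1..<n}},
     mult = (*), one = 1, zero = 0, add = (+)\<rparr>"

definition qhat :: "complex \<Rightarrow> complex" where
  "qhat q = q - inverse q"

definition qint :: "complex \<Rightarrow> int \<Rightarrow> complex" where
  "qint q k = (q powi k - q powi (- k)) / (q - inverse q)"

definition bwm_relators :: "complex \<Rightarrow> complex \<Rightarrow> nat \<Rightarrow> ncpoly set" where
  "bwm_relators q r n =
     {g i * g (i+1) * g i - g (i+1) * g i * g (i+1) | i. 1 \<le> i \<and> i + 1 < n}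
   \<union> {g i * g j - g j * g i | i j. i \<in> {1..<n} \<and> j \<in> {1..<n} \<and> \<bar>int i - int j\<bar> > 1}
   \<union> {g i * g i - (1 + const (qhat q) * g i - const (inverse r * qhat q) * e i) | i. i \<in> {1..<n}}
   \<union> {g i * e i - const (inverse r) * e i | i. i \<in> {1..<n}}
   \<union> {e i * g i - const (inverse r) * e i | i. i \<in> {1..<n}}
   \<union> {g i * g (i+1) * e i - e (i+1) * e i | i. 1 \<le> i \<and> i + 1 < n}
   \<union> {g (i+1) * g i * e (i+1) - e i * e (i+1) | i. 1 \<le> i \<and> i + 1 < n}"

definition bwm_ideal :: "complex \<Rightarrow> complex \<Rightarrow> nat \<Rightarrow> ncpoly set" where
  "bwm_ideal q r n = genideal (free_alg n) (bwm_relators q r n)"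

definition BWM :: "complex \<Rightarrow> complex \<Rightarrow> nat \<Rightarrow> ncpoly set ring" where
  "BWM q r n = free_alg n Quot bwm_ideal q r n"

definition cls :: "complex \<Rightarrow> complex \<Rightarrow> nat \<Rightarrow> ncpoly \<Rightarrow> ncpoly set" where
  "cls q r n p = bwm_ideal q r n +>\<^bsub>free_alg n\<^esub> p"

definition scale :: "complex \<Rightarrow> complex \<Rightarrow> nat \<Rightarrow> complex \<Rightarrow> ncpoly set \<Rightarrow> ncpoly set" where
  "scale q r n c X = cls q r n (const c) \<otimes>\<^bsub>BWM q r n\<^esub> X"

text \<open>The algebra homomorphism of free algebras that replaces every index \<open>i\<close> by \<open>f i\<close>,
  and the map it induces on the quotients (see \<open>bwm_map_cls\<close> below for well-definedness).\<close>

definition reindex :: "(nat \<Rightarrow> nat) \<Rightarrow> ncpoly \<Rightarrow> ncpoly" where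
  "reindex f p = (\<Sum>w\<in>Poly_Mapping.keys p.
     Poly_Mapping.single (Word (map (map_bwm_gen f) (letters w))) (Poly_Mapping.lookup p w))"

definition bwm_map :: "complex \<Rightarrow> complex \<Rightarrow> (nat \<Rightarrow> nat) \<Rightarrow> nat \<Rightarrow> nat \<Rightarrow> ncpoly set \<Rightarrow> ncpoly set" where
  "bwm_map q r f m n X = the_elem ((\<lambda>p. cls q r n (reindex f p)) ` X)"

definition bwm_embed :: "complex \<Rightarrow> complex \<Rightarrow> nat \<Rightarrow> nat \<Rightarrow> ncpoly set \<Rightarrow> ncpoly set" where
  "bwm_embed q r m n = bwm_map q r id m n"

definition bwm_shift :: "complex \<Rightarrow> complex \<Rightarrow> nat \<Rightarrow> nat \<Rightarrow> ncpoly set \<Rightarrow> ncpoly set" where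
  "bwm_shift q r m n = bwm_map q r Suc m n"

definition is_symmetrizer :: "complex \<Rightarrow> complex \<Rightarrow> nat \<Rightarrow> ncpoly set \<Rightarrow> bool" where
  "is_symmetrizer q r n S \<longleftrightarrow>
     S \<in> carrier (BWM q r n) \<and> S \<noteq> \<zero>\<^bsub>BWM q r n\<^esub> \<and>
     S \<otimes>\<^bsub>BWM q r n\<^esub> S = S \<and>
     (\<forall>i\<in>{1..<n}. S \<otimes>\<^bsub>BWM q r n\<^esub> cls q r n (g i) = scale q r n q S)"

definition symmetrizer :: "complex \<Rightarrow> complex \<Rightarrow> nat \<Rightarrow> ncpoly set" where
  "symmetrizer q r n = (THE S. is_symmetrizer q r n S)"

text \<open>\<open>gs xs\<close> and \<open>es xs\<close> are ordered products; \<open>rev [a..<b]\<close> gives the descending index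
  sequence \<open>b - 1, \<dots>, a\<close>.\<close>

definition gs :: "nat list \<Rightarrow> ncpoly" where
  "gs xs = prod_list (map g xs)"

definition es :: "nat list \<Rightarrow> ncpoly" where
  "es xs = prod_list (map e xs)"

definition d :: "complex \<Rightarrow> nat \<Rightarrow> nat \<Rightarrow> ncpoly" where
  "d q k i = es (rev [i..<k]) * (\<Sum>j=0..i-1. const (q^j) * gs (rev [i-j..<i]))"

definition d' :: "complex \<Rightarrow> nat \<Rightarrow> nat \<Rightarrow> ncpoly" where
  "d' q k i = es [1..<k-i+1] * (\<Sum>j=0..i-1. const (q^j) * gs [k+1-i..<k-i+j+1])"

definition dbar :: "complex \<Rightarrow> nat \<Rightarrow> nat \<Rightarrow> ncpoly" where
  "dbar q k i = (\<Sum>j=0..i-1. const (q^j) * gs [i-j..<i]) * es [i..<k]"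

definition dbar' :: "complex \<Rightarrow> nat \<Rightarrow> nat \<Rightarrow> ncpoly" where
  "dbar' q k i = (\<Sum>j=0..i-1. const (q^j) * gs (rev [k+1-i..<k-i+j+1])) * es (rev [1..<k-i+1])"

definition b_k1 :: "complex \<Rightarrow> complex \<Rightarrow> nat \<Rightarrow> ncpoly" where
  "b_k1 q r k = (\<Sum>i=0..k. const (q^i) * gs (rev [k+1-i..<k+1]))
     + const (qhat q / (1 - q powi (2 * int k - 1) * r))
       * (\<Sum>i=1..k. const (q^(2*k-2*i+1)) * d q (k+1) i)"

definition b_1k :: "complex \<Rightarrow> complex \<Rightarrow> nat \<Rightarrow> ncpoly" where
  "b_1k q r k = (\<Sum>i=0..k. const (q^i) * gs [1..<i+1])
     + const (qhat q / (1 - q powi (2 * int k - 1) * r))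
       * (\<Sum>i=1..k. const (q^(2*k-2*i+1)) * d' q (k+1) i)"

definition a_k1 :: "complex \<Rightarrow> complex \<Rightarrow> nat \<Rightarrow> ncpoly" where
  "a_k1 q r k = (\<Sum>i=0..k. const (q^i) * gs [k+1-i..<k+1])
     + const (qhat q / (1 - q powi (2 * int k - 1) * r))
       * (\<Sum>i=1..k. const (q^(2*k-2*i+1)) * dbar q (k+1) i)"

definition a_1k :: "complex \<Rightarrow> complex \<Rightarrow> nat \<Rightarrow> ncpoly" where
  "a_1k q r k = (\<Sum>i=0..k. const (q^i) * gs (rev [1..<i+1]))
     + const (qhat q / (1 - q powi (2 * int k - 1) * r))
       * (\<Sum>i=1..k. const (q^(2*k-2*i+1)) * dbar' q (k+1) i)"

lemma free_alg_sel [simp]: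
  "mult (free_alg n) = (*)" "one (free_alg n) = 1" "zero (free_alg n) = 0" "add (free_alg n) = (+)"
  by (simp_all add: free_alg_def)

lemma free_alg_carrier:
  "p \<in> carrier (free_alg n) \<longleftrightarrow>
    (\<forall>w\<in>Poly_Mapping.keys p. \<forall>x\<in>set (letters w). gen_indices x \<subseteq> {1..<n})"
  by (simp add: free_alg_def)

lemma free_alg_closed:
  "p \<in> carrier (free_alg n) \<Longrightarrow> s \<in> carrier (free_alg n) \<Longrightarrow> p + s \<in> carrier (free_alg n)"
  "p \<in> carrier (free_alg n) \<Longrightarrow> s \<in> carrier (free_alg n) \<Longrightarrow> p - s \<in> carrier (free_alg n)"
  "p \<in> carrier (free_alg n) \<Longrightarrow> s \<in> carrier (free_alg n) \<Longrightarrow> p * s \<in> carrier (free_alg n)"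
  "p \<in> carrier (free_alg n) \<Longrightarrow> - p \<in> carrier (free_alg n)"
  "0 \<in> carrier (free_alg n)" "1 \<in> carrier (free_alg n)" "const c \<in> carrier (free_alg n)"
  "i \<in> {1..<n} \<Longrightarrow> g i \<in> carrier (free_alg n)" "i \<in> {1..<n} \<Longrightarrow> e i \<in> carrier (free_alg n)"
proof -
  show add: "p + s \<in> carrier (free_alg n)"
    if "p \<in> carrier (free_alg n)" "s \<in> carrier (free_alg n)" for p s
    using that Poly_Mapping.keys_add[of p s] unfolding free_alg_carrier by blast
  show uminus: "- p \<in> carrier (free_alg n)" if "p \<in> carrier (free_alg n)" for p
    using that unfolding free_alg_carrier by (simp add: in_keys_iff)
  show "p - s \<in> carrier (free_alg n)"
    if "p \<in> carrier (free_alg n)" "s \<in> carrier (free_alg n)"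
    using add[OF that(1) uminus[OF that(2)]] by simp
  show "p * s \<in> carrier (free_alg n)"
    if "p \<in> carrier (free_alg n)" "s \<in> carrier (free_alg n)"
    unfolding free_alg_carrier
  proof (intro ballI)
    fix w x assume "w \<in> Poly_Mapping.keys (p * s)" and x: "x \<in> set (letters w)"
    then obtain u v where uv: "w = u + v" "u \<in> Poly_Mapping.keys p" "v \<in> Poly_Mapping.keys s"
      using Poly_Mapping.keys_mult[of p s] by blast
    then have "x \<in> set (letters u) \<or> x \<in> set (letters v)"
      using x by (simp add: plus_bwm_word_def)
    then show "gen_indices x \<subseteq> {1..<n}"
      using that uv unfolding free_alg_carrier by blast
  qed
qed (auto simp: free_alg_carrier const_def g_def e_def zero_bwm_word_def)

lemma ring_free_alg: "ring (free_alg n)"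
proof (rule ringI)
  show "abelian_group (free_alg n)"
  proof (rule abelian_groupI)
    fix x assume "x \<in> carrier (free_alg n)"
    then show "\<exists>y\<in>carrier (free_alg n). y \<oplus>\<^bsub>free_alg n\<^esub> x = \<zero>\<^bsub>free_alg n\<^esub>"
      by (intro bexI[of _ "- x"]) (auto simp: free_alg_closed)
  qed (auto simp: free_alg_closed algebra_simps)
  show "monoid (free_alg n)"
    by (rule monoidI) (auto simp: free_alg_closed algebra_simps)
qed (auto simp: algebra_simps)

lemma relators_closed: "bwm_relators q r n \<subseteq> carrier (free_alg n)"
  unfolding bwm_relators_def by (auto intro!: free_alg_closed)

lemma ideal_bwm: "ideal (bwm_ideal q r n) (free_alg n)"
  unfolding bwm_ideal_def by (rule ring.genideal_ideal[OF ring_free_alg relators_closed])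

lemma ring_BWM: "ring (BWM q r n)"
  unfolding BWM_def by (rule ideal.quotient_is_ring[OF ideal_bwm])

lemma cls_ring_hom: "cls q r n \<in> ring_hom (free_alg n) (BWM q r n)"
  using ideal.rcos_ring_hom[OF ideal_bwm[of q r n]] unfolding BWM_def cls_def[abs_def] .

lemma reindex_superset:
  assumes "finite A" "Poly_Mapping.keys p \<subseteq> A"
  shows "reindex f p = (\<Sum>w\<in>A.
     Poly_Mapping.single (Word (map (map_bwm_gen f) (letters w))) (Poly_Mapping.lookup p w))"
  unfolding reindex_def
  by (rule sum.mono_neutral_left) (use assms in \<open>auto simp: in_keys_iff\<close>)

lemma reindex_single:
  "reindex f (Poly_Mapping.single w c) = Poly_Mapping.single (Word (map (map_bwm_gen f) (letters w))) c"
  using reindex_superset[of "{w}" "Poly_Mapping.single w c" f] by (simp add: keys_single)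

lemma reindex_add: "reindex f (p + s) = reindex f p + reindex f s"
proof -
  let ?A = "Poly_Mapping.keys p \<union> Poly_Mapping.keys s"
  show ?thesis
    using Poly_Mapping.keys_add[of p s]
    by (simp add: reindex_superset[of ?A] lookup_add single_add sum.distrib)
qed

lemma reindex_minus: "reindex f (- p) = - reindex f p"
  using reindex_add[of f p "- p"] reindex_add[of f 0 0]
  by (simp add: eq_neg_iff_add_eq_0 add.commute)

lemma reindex_diff: "reindex f (p - s) = reindex f p - reindex f s"
  using reindex_add[of f p "- s"] by (simp add: reindex_minus)

lemma reindex_zero [simp]: "reindex f 0 = 0"
  by (simp add: reindex_def)

lemma reindex_sum: "reindex f (sum h A) = (\<Sum>x\<in>A. reindex f (h x))"
  by (induction A rule: infinite_finite_induct) (simp_all add: reindex_add)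

lemma ncpoly_expand:
  "p = (\<Sum>w\<in>Poly_Mapping.keys p. Poly_Mapping.single w (Poly_Mapping.lookup p w))" for p :: ncpoly
proof (rule poly_mapping_eqI)
  fix v
  have "(\<Sum>w\<in>Poly_Mapping.keys p. Poly_Mapping.lookup p w when w = v)
      = (\<Sum>w\<in>Poly_Mapping.keys p. if w = v then Poly_Mapping.lookup p v else 0)"
    by (rule sum.cong) (auto simp: when_def)
  also have "\<dots> = Poly_Mapping.lookup p v"
    by (simp add: sum.delta in_keys_iff)
  finally show "Poly_Mapping.lookup p v = Poly_Mapping.lookup
      (\<Sum>w\<in>Poly_Mapping.keys p. Poly_Mapping.single w (Poly_Mapping.lookup p w)) v"
    by (simp add: lookup_sum lookup_single)
qed

lemma reindex_mult: "reindex f (p * s) = reindex f p * reindex f s"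
proof -
  let ?a = "\<lambda>w. Poly_Mapping.single w (Poly_Mapping.lookup p w)"
  let ?b = "\<lambda>w. Poly_Mapping.single w (Poly_Mapping.lookup s w)"
  have *: "reindex f (?a u * ?b v) = reindex f (?a u) * reindex f (?b v)" for u v
    by (simp add: mult_single reindex_single plus_bwm_word_def)
  have "p * s = (\<Sum>u\<in>Poly_Mapping.keys p. \<Sum>v\<in>Poly_Mapping.keys s. ?a u * ?b v)"
    unfolding sum_product[symmetric] ncpoly_expand[symmetric] ..
  then have "reindex f (p * s) = (\<Sum>u\<in>Poly_Mapping.keys p. \<Sum>v\<in>Poly_Mapping.keys s.
      reindex f (?a u) * reindex f (?b v))"
    by (simp add: reindex_sum *)
  also have "\<dots> = reindex f (\<Sum>u\<in>Poly_Mapping.keys p. ?a u) * reindex f (\<Sum>v\<in>Poly_Mapping.keys s. ?b v)"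
    by (simp add: sum_product reindex_sum)
  finally show ?thesis unfolding ncpoly_expand[symmetric] .
qed

lemma reindex_simps [simp]:
  "reindex f (const c) = const c" "reindex f 1 = 1" "reindex f (g i) = g (f i)" "reindex f (e i) = e (f i)"
  by (simp_all add: const_def g_def e_def reindex_single zero_bwm_word_def flip: single_one)

lemma reindex_closed:
  assumes "p \<in> carrier (free_alg m)" "f ` {1..<m} \<subseteq> {1..<n}"
  shows "reindex f p \<in> carrier (free_alg n)"
  unfolding free_alg_carrier
proof (intro ballI)
  fix w x assume "w \<in> Poly_Mapping.keys (reindex f p)" and x: "x \<in> set (letters w)"
  then obtain u where u: "u \<in> Poly_Mapping.keys p" "w = Word (map (map_bwm_gen f) (letters u))"
    unfolding reindex_def using Poly_Mapping.keys_sum by (fastforce split: if_splits)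
  with x obtain y where "y \<in> set (letters u)" "x = map_bwm_gen f y" by auto
  with u(1) assms show "gen_indices x \<subseteq> {1..<n}"
    unfolding free_alg_carrier by (fastforce simp: bwm_gen.set_map)
qed

lemma bwm_relators_intros:
  "1 \<le> i \<Longrightarrow> i + 1 < n \<Longrightarrow>
     g i * g (i+1) * g i - g (i+1) * g i * g (i+1) \<in> bwm_relators q r n"
  "i \<in> {1..<n} \<Longrightarrow> j \<in> {1..<n} \<Longrightarrow> \<bar>int i - int j\<bar> > 1 \<Longrightarrow>
     g i * g j - g j * g i \<in> bwm_relators q r n"
  "i \<in> {1..<n} \<Longrightarrow>
     g i * g i - (1 + const (qhat q) * g i - const (inverse r * qhat q) * e i) \<in> bwm_relators q r n"
  "i \<in> {1..<n} \<Longrightarrow>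
     g i * e i - const (inverse r) * e i \<in> bwm_relators q r n"
  "i \<in> {1..<n} \<Longrightarrow>
     e i * g i - const (inverse r) * e i \<in> bwm_relators q r n"
  "1 \<le> i \<Longrightarrow> i + 1 < n \<Longrightarrow>
     g i * g (i+1) * e i - e (i+1) * e i \<in> bwm_relators q r n"
  "1 \<le> i \<Longrightarrow> i + 1 < n \<Longrightarrow>
     g (i+1) * g i * e (i+1) - e i * e (i+1) \<in> bwm_relators q r n"
  unfolding bwm_relators_def by blast+

lemma bwm_relators_cases [consumes 1]:
  assumes "x \<in> bwm_relators q r n"
  obtains
    (1) i where "1 \<le> i" "i + 1 < n"
      "x = g i * g (i+1) * g i - g (i+1) * g i * g (i+1)"
  | (2) i j where "i \<in> {1..<n}" "j \<in> {1..<n}" "\<bar>int i - int j\<bar> > 1"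
      "x = g i * g j - g j * g i"
  | (3) i where "i \<in> {1..<n}"
      "x = g i * g i - (1 + const (qhat q) * g i - const (inverse r * qhat q) * e i)"
  | (4) i where "i \<in> {1..<n}"
      "x = g i * e i - const (inverse r) * e i"
  | (5) i where "i \<in> {1..<n}"
      "x = e i * g i - const (inverse r) * e i"
  | (6) i where "1 \<le> i" "i + 1 < n"
      "x = g i * g (i+1) * e i - e (i+1) * e i"
  | (7) i where "1 \<le> i" "i + 1 < n"
      "x = g (i+1) * g i * e (i+1) - e i * e (i+1)"
  using assms unfolding bwm_relators_def by blast

lemma reindex_ideal:
  assumes f: "f = id \<and> m \<le> n \<or> f = Suc \<and> m < n" and p: "p \<in> bwm_ideal q r m"
  shows "reindex f p \<in> bwm_ideal q r n"
proof -
  have fi: "f ` {1..<m} \<subseteq> {1..<n}" using f by auto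
  interpret I: ideal "bwm_ideal q r n" "free_alg n" by (rule ideal_bwm)
  have "reindex f \<in> ring_hom (free_alg m) (free_alg n)"
    by (rule ring_hom_memI) (auto simp: reindex_add reindex_mult reindex_closed[OF _ fi])
  then interpret h: ring_hom_ring "free_alg m" "free_alg n" "reindex f"
    by (intro ring_hom_ringI2 ring_free_alg)
  let ?J = "{p \<in> carrier (free_alg m). reindex f p \<in> bwm_ideal q r n}"
  have "ideal ?J (free_alg m)"
    by (rule h.ideal_vimage[OF ideal_bwm])
  moreover have rel: "bwm_relators q r n \<subseteq> bwm_ideal q r n"
    unfolding bwm_ideal_def by (rule ring.genideal_self[OF ring_free_alg relators_closed])
  have le: "f i \<in> {1..<n}" if "i \<in> {1..<m}" for i
    using fi that by blast
  have step: "f (Suc i) = Suc (f i)" for i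
    using f by auto
  have dist: "\<bar>int (f i) - int (f j)\<bar> = \<bar>int i - int j\<bar>" for i j
    using f by auto
  have "reindex f x \<in> bwm_relators q r n" if "x \<in> bwm_relators q r m" for x
    using that
  proof (cases rule: bwm_relators_cases)
    case (1 i)
    then show ?thesis using le[of i] le[of "i+1"] bwm_relators_intros(1)[of "f i" n q r]
      by (simp add: reindex_mult reindex_diff step)
  next
    case (2 i j)
    then show ?thesis using le[of i] le[of j] bwm_relators_intros(2)[of "f i" n "f j" q r]
      by (simp add: reindex_mult reindex_diff dist)
  next
    case (3 i)
    then show ?thesis using le[of i] bwm_relators_intros(3)[of "f i" n q r]
      by (simp add: reindex_mult reindex_diff reindex_add)
  next
    case (4 i)
    then show ?thesis using le[of i] bwm_relators_intros(4)[of "f i" n r q]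
      by (simp add: reindex_mult reindex_diff)
  next
    case (5 i)
    then show ?thesis using le[of i] bwm_relators_intros(5)[of "f i" n r q]
      by (simp add: reindex_mult reindex_diff)
  next
    case (6 i)
    then show ?thesis using le[of i] le[of "i+1"] bwm_relators_intros(6)[of "f i" n q r]
      by (simp add: reindex_mult reindex_diff step)
  next
    case (7 i)
    then show ?thesis using le[of i] le[of "i+1"] bwm_relators_intros(7)[of "f i" n q r]
      by (simp add: reindex_mult reindex_diff step)
  qed
  with rel relators_closed[of q r m] have "bwm_relators q r m \<subseteq> ?J" by blast
  ultimately have "bwm_ideal q r m \<subseteq> ?J"
    unfolding bwm_ideal_def by (intro ring.genideal_minimal[OF ring_free_alg]) auto
  with p show ?thesis by auto
qed

lemma bwm_map_cls:
  assumes f: "f = id \<and> m \<le> n \<or> f = Suc \<and> m < n" and p: "p \<in> carrier (free_alg m)"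
  shows "bwm_map q r f m n (cls q r m p) = cls q r n (reindex f p)"
proof -
  have fi: "f ` {1..<m} \<subseteq> {1..<n}" using f by auto
  interpret I: ideal "bwm_ideal q r m" "free_alg m" by (rule ideal_bwm)
  interpret J: ideal "bwm_ideal q r n" "free_alg n" by (rule ideal_bwm)
  have "cls q r n (reindex f s) = cls q r n (reindex f p)" if "s \<in> cls q r m p" for s
  proof -
    obtain h where h: "h \<in> bwm_ideal q r m" "s = h + p"
      using \<open>s \<in> cls q r m p\<close> unfolding cls_def a_r_coset_def' by auto
    have "reindex f s \<in> cls q r n (reindex f p)"
      using reindex_ideal[OF f h(1)] h(2)
      unfolding cls_def a_r_coset_def' by (auto simp: reindex_add)
    then show ?thesis
      unfolding cls_def
      using J.a_repr_independence[OF _ reindex_closed[OF p fi]] J.a_subgroup by simp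
  qed
  then have "(\<lambda>s. cls q r n (reindex f s)) ` cls q r m p = (\<lambda>_. cls q r n (reindex f p)) ` cls q r m p"
    by (rule image_cong[OF refl])
  moreover have "cls q r m p \<noteq> {}"
    using I.a_rcos_self[OF p] unfolding cls_def by blast
  ultimately show ?thesis by (simp add: bwm_map_def image_constant_conv)
qed

end

theory Submission
  imports Defs
begin

text \<open>
  Let \<open>S\<close> be any element with \<open>S g\<^sub>i = q S\<close> for \<open>i < k\<close>. Then \<open>S e\<^sub>i = 0\<close>. Put
  \<open>A\<^sub>p = S g\<^sub>k \<dots> g\<^sub>p\<close> and \<open>B\<^sub>i\<^sub>p = S e\<^sub>k \<dots> e\<^sub>i g\<^sub>i\<^sub>-\<^sub>1 \<dots> g\<^sub>p\<close>. Right multiplication by \<open>g\<^sub>m\<close> multiplies most of these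
  vectors by \<open>q\<close>; on the others it changes one of the indices \<open>p\<close> and \<open>i\<close> by one, up to multiples of the vector itself
  and of \<open>B\<^sub>m\<^sub>m\<close>. The product
  \<open>S b\<^sub>k\<^sub>,\<^sub>1\<close> is a combination of the \<open>A\<^sub>p\<close> plus a constant times a combination of the \<open>B\<^sub>i\<^sub>p\<close>. In each of the two sums
  the defect \<open>x g\<^sub>m - q x\<close> telescopes to a single multiple of \<open>B\<^sub>m\<^sub>m\<close>, namely \<open>- r\<^sup>-\<^sup>1 (q - q\<^sup>-\<^sup>1) q\<close>
  (lemma \<open>gvec_defect\<close>) and \<open>r\<^sup>-\<^sup>1 q - q\<^sup>2\<^sup>k\<close> (lemma \<open>evec_defect\<close>), and the denominator
  \<open>1 - q\<^sup>2\<^sup>k\<^sup>-\<^sup>1 r\<close> is exactly what makes the two cancel. Hence \<open>S b\<^sub>k\<^sub>,\<^sub>1\<close> satisfies the same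
  equations for all \<open>m \<le> k\<close> (theorem \<open>fixed_S_b\<close>).

  The other three products follow by symmetry: \<open>g\<^sub>i \<mapsto> g\<^sub>k\<^sub>+\<^sub>1\<^sub>-\<^sub>i\<close> is an automorphism that carries
  \<open>b\<^sub>k\<^sub>,\<^sub>1\<close> to \<open>b\<^sub>1\<^sub>,\<^sub>k\<close>, and the opposite algebra satisfies the same relations, with \<open>b\<close> and \<open>a\<close> exchanged.
  Iterating the first and the third recursion from \<open>1\<close> gives a right and a left invariant element. The character
  \<open>g\<^sub>i \<mapsto> q\<close>, \<open>e\<^sub>i \<mapsto> 0\<close> has the value \<open>1\<close> on both, and computing their product in two ways shows that they are
  equal. The same computation shows that any right or left invariant element on which the character is \<open>1\<close> equals
  this one (lemma \<open>fixed_unique\<close>), which yields the four formulas as well as existence and uniqueness of the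
  symmetrizer; the character also shows that the symmetrizer is nonzero.

  The argument uses only the relations and the genericity of \<open>q\<close> and \<open>r\<close>, so it is carried out for a representation in an arbitrary ring type
  (locale \<open>bwm_rep\<close>). To apply it to the quotient by an ideal that depends on \<open>q\<close>, \<open>r\<close> and \<open>n\<close>, the product of
  all these quotients is made into one ring type. The generators of a single factor extend to the whole product
  because the character satisfies the relations in all other factors.
\<close>

section \<open>Evaluating noncommutative polynomials in an algebra\<close>

text \<open>Algebras over the complex numbers with the scalar multiplication as a parameter: the opposite of an algebra,
  the product of all BWM algebras and \<open>complex\<close> itself are then instances.\<close>

locale complex_algebra = vector_space smul
  for smul :: "complex \<Rightarrow> 'a::{ring,monoid_mult} \<Rightarrow> 'a" (infixr "\<cdot>" 75) +
  assumes smul_mult_left [simp]: "(c \<cdot> x) * y = c \<cdot> (x * y)"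
    and smul_mult_right [simp]: "x * (c \<cdot> y) = c \<cdot> (x * y)"

text \<open>The homomorphism from the free algebra given by its universal property.\<close>

definition ev :: "(complex \<Rightarrow> 'a \<Rightarrow> 'a) \<Rightarrow> (nat \<Rightarrow> 'a) \<Rightarrow> (nat \<Rightarrow> 'a) \<Rightarrow> ncpoly \<Rightarrow> 'a::{ring,monoid_mult}"
  where "ev smul \<gamma> \<epsilon> p = (\<Sum>w\<in>Poly_Mapping.keys p.
    smul (Poly_Mapping.lookup p w) (prod_list (map (case_bwm_gen \<gamma> \<epsilon>) (letters w))))"

context complex_algebra
begin

lemma ev_superset:
  assumes "finite A" "Poly_Mapping.keys p \<subseteq> A"
  shows "ev (\<cdot>) \<gamma> \<epsilon> p =
    (\<Sum>w\<in>A. Poly_Mapping.lookup p w \<cdot> prod_list (map (case_bwm_gen \<gamma> \<epsilon>) (letters w)))"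
  unfolding ev_def
  by (rule sum.mono_neutral_left) (use assms in \<open>auto simp: in_keys_iff\<close>)

lemma ev_single [simp]:
  "ev (\<cdot>) \<gamma> \<epsilon> (Poly_Mapping.single w c) = c \<cdot> prod_list (map (case_bwm_gen \<gamma> \<epsilon>) (letters w))"
  using ev_superset[of "{w}" "Poly_Mapping.single w c" \<gamma> \<epsilon>] by simp

lemma ev_zero [simp]: "ev (\<cdot>) \<gamma> \<epsilon> 0 = 0"
  by (simp add: ev_def)

lemma ev_add [simp]: "ev (\<cdot>) \<gamma> \<epsilon> (p + s) = ev (\<cdot>) \<gamma> \<epsilon> p + ev (\<cdot>) \<gamma> \<epsilon> s"
proof -
  let ?A = "Poly_Mapping.keys p \<union> Poly_Mapping.keys s"
  show ?thesis
    using Poly_Mapping.keys_add[of p s]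
    by (simp add: ev_superset[of ?A] lookup_add scale_left_distrib sum.distrib)
qed

lemma ev_minus [simp]: "ev (\<cdot>) \<gamma> \<epsilon> (- p) = - ev (\<cdot>) \<gamma> \<epsilon> p"
  using ev_add[of \<gamma> \<epsilon> p "- p"] by (metis add.right_inverse ev_zero minus_unique)

lemma ev_diff [simp]: "ev (\<cdot>) \<gamma> \<epsilon> (p - s) = ev (\<cdot>) \<gamma> \<epsilon> p - ev (\<cdot>) \<gamma> \<epsilon> s"
  using ev_add[of \<gamma> \<epsilon> p "- s"] by simp

lemma ev_sum [simp]: "ev (\<cdot>) \<gamma> \<epsilon> (sum h A) = (\<Sum>x\<in>A. ev (\<cdot>) \<gamma> \<epsilon> (h x))"
  by (induction A rule: infinite_finite_induct) simp_all

lemma ev_mult [simp]: "ev (\<cdot>) \<gamma> \<epsilon> (p * s) = ev (\<cdot>) \<gamma> \<epsilon> p * ev (\<cdot>) \<gamma> \<epsilon> s"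
proof -
  let ?a = "\<lambda>w. Poly_Mapping.single w (Poly_Mapping.lookup p w)"
  let ?b = "\<lambda>w. Poly_Mapping.single w (Poly_Mapping.lookup s w)"
  have *: "ev (\<cdot>) \<gamma> \<epsilon> (?a u * ?b v) = ev (\<cdot>) \<gamma> \<epsilon> (?a u) * ev (\<cdot>) \<gamma> \<epsilon> (?b v)" for u v
    by (simp add: mult_single plus_bwm_word_def)
  have "p * s = (\<Sum>u\<in>Poly_Mapping.keys p. \<Sum>v\<in>Poly_Mapping.keys s. ?a u * ?b v)"
    unfolding sum_product[symmetric] ncpoly_expand[symmetric] ..
  then have "ev (\<cdot>) \<gamma> \<epsilon> (p * s) = (\<Sum>u\<in>Poly_Mapping.keys p. \<Sum>v\<in>Poly_Mapping.keys s.
      ev (\<cdot>) \<gamma> \<epsilon> (?a u) * ev (\<cdot>) \<gamma> \<epsilon> (?b v))"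
    by (simp only: ev_sum *)
  also have "\<dots> = ev (\<cdot>) \<gamma> \<epsilon> (\<Sum>u\<in>Poly_Mapping.keys p. ?a u)
      * ev (\<cdot>) \<gamma> \<epsilon> (\<Sum>v\<in>Poly_Mapping.keys s. ?b v)"
    by (simp only: sum_product ev_sum)
  finally show ?thesis unfolding ncpoly_expand[symmetric] .
qed

lemma ev_const [simp]: "ev (\<cdot>) \<gamma> \<epsilon> (const c) = c \<cdot> 1"
  by (simp add: const_def zero_bwm_word_def)

lemma ev_generators [simp]:
  "ev (\<cdot>) \<gamma> \<epsilon> 1 = 1" "ev (\<cdot>) \<gamma> \<epsilon> (g i) = \<gamma> i" "ev (\<cdot>) \<gamma> \<epsilon> (e i) = \<epsilon> i"
  by (simp_all add: g_def e_def zero_bwm_word_def flip: single_one)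

lemma ev_gs [simp]: "ev (\<cdot>) \<gamma> \<epsilon> (gs xs) = prod_list (map \<gamma> xs)"
  by (induction xs) (simp_all add: gs_def)

lemma ev_es [simp]: "ev (\<cdot>) \<gamma> \<epsilon> (es xs) = prod_list (map \<epsilon> xs)"
  by (induction xs) (simp_all add: es_def)

lemma ev_reindex: "ev (\<cdot>) \<gamma> \<epsilon> (reindex f p) = ev (\<cdot>) (\<gamma> \<circ> f) (\<epsilon> \<circ> f) p"
proof -
  have *: "case_bwm_gen \<gamma> \<epsilon> \<circ> map_bwm_gen f = case_bwm_gen (\<gamma> \<circ> f) (\<epsilon> \<circ> f)"
    by (rule ext) (simp split: bwm_gen.split)
  show ?thesis
    by (simp add: reindex_def * ev_def[of _ "\<gamma> \<circ> f"])
qed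

end

section \<open>Algebras satisfying the BWM relations\<close>

locale bwm_params =
  fixes q r :: complex
  assumes q_nz [simp]: "q \<noteq> 0" and r_nz [simp]: "r \<noteq> 0"
    and q_power: "k > 0 \<Longrightarrow> q ^ k \<noteq> 1"
    and r_generic: "r \<noteq> q powi j \<and> r \<noteq> - (q powi j)"
begin

lemma qhat_nz [simp]: "qhat q \<noteq> 0"
  using q_power[of 2] by (simp add: qhat_def power2_eq_square field_simps)

lemma inverse_r_neq_q: "inverse r \<noteq> q"
  using r_generic[of "-1"] by (metis inverse_inverse_eq power_int_minus power_int_1_right)

lemma q_qhat: "1 + q * qhat q = q * q"
  by (simp add: qhat_def field_simps)

lemma qhat_geometric: "qhat q * q * (\<Sum>s<N. q ^ (2 * s)) = q ^ (2 * N) - 1"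
  by (induction N) (simp_all add: qhat_def field_simps power2_eq_square)

text \<open>The denominator in the definition of \<open>b\<^sub>k\<^sub>,\<^sub>1\<close> vanishes only if \<open>r\<close> is an integral power of \<open>q\<close>.\<close>

lemma coefficient_denominator:
  assumes "1 \<le> k"
  shows "1 - q powi (2 * int k - 1) * r = 1 - q ^ (2 * k) / q * r"
    and "1 - q powi (2 * int k - 1) * r \<noteq> 0"
proof -
  show "1 - q powi (2 * int k - 1) * r = 1 - q ^ (2 * k) / q * r"
    using power_int_diff[of q "int (2 * k)" 1] power_int_of_nat[of q "2 * k"] by simp
  show "1 - q powi (2 * int k - 1) * r \<noteq> 0"
    using r_generic[of "- (2 * int k - 1)"] unfolding power_int_minus
    by (metis eq_iff_diff_eq_0 inverse_unique)
qed

end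

locale bwm_rep = complex_algebra smul + bwm_params q r
  for smul :: "complex \<Rightarrow> 'a::{ring,monoid_mult} \<Rightarrow> 'a" (infixr "\<cdot>" 75) and q r :: complex +
  fixes \<gamma> \<epsilon> :: "nat \<Rightarrow> 'a" and n :: nat
  assumes braid: "\<lbrakk>1 \<le> i; Suc i < n\<rbrakk> \<Longrightarrow> \<gamma> i * \<gamma> (Suc i) * \<gamma> i = \<gamma> (Suc i) * \<gamma> i * \<gamma> (Suc i)"
    and GG_comm: "\<lbrakk>1 \<le> i; Suc i < j; j < n\<rbrakk> \<Longrightarrow> \<gamma> i * \<gamma> j = \<gamma> j * \<gamma> i"
    and quad: "\<lbrakk>1 \<le> i; i < n\<rbrakk> \<Longrightarrow> \<gamma> i * \<gamma> i = 1 + qhat q \<cdot> \<gamma> i - (inverse r * qhat q) \<cdot> \<epsilon> i"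
    and GE: "\<lbrakk>1 \<le> i; i < n\<rbrakk> \<Longrightarrow> \<gamma> i * \<epsilon> i = inverse r \<cdot> \<epsilon> i"
    and EG: "\<lbrakk>1 \<le> i; i < n\<rbrakk> \<Longrightarrow> \<epsilon> i * \<gamma> i = inverse r \<cdot> \<epsilon> i"
    and GGE: "\<lbrakk>1 \<le> i; Suc i < n\<rbrakk> \<Longrightarrow> \<gamma> i * \<gamma> (Suc i) * \<epsilon> i = \<epsilon> (Suc i) * \<epsilon> i"
    and GGE': "\<lbrakk>1 \<le> i; Suc i < n\<rbrakk> \<Longrightarrow> \<gamma> (Suc i) * \<gamma> i * \<epsilon> (Suc i) = \<epsilon> i * \<epsilon> (Suc i)"
begin

lemma E_poly:
  assumes "1 \<le> i" "i < n"
  shows "\<epsilon> i = (r / qhat q) \<cdot> (1 + qhat q \<cdot> \<gamma> i - \<gamma> i * \<gamma> i)"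
  using assms by (simp add: quad)

text \<open>As \<open>q - q\<^sup>-\<^sup>1 \<noteq> 0\<close>, the quadratic relation expresses \<open>e\<^sub>i\<close> as a polynomial in \<open>g\<^sub>i\<close>; so commutation and
  conjugation relations between the \<open>g\<^sub>i\<close> are inherited by the \<open>e\<^sub>i\<close>.\<close>

lemma E_intertwine:
  assumes "1 \<le> i" "i < n" "1 \<le> j" "j < n" and x: "x * \<gamma> i = \<gamma> j * x"
  shows "x * \<epsilon> i = \<epsilon> j * x"
proof -
  have "x * (\<gamma> i * \<gamma> i) = \<gamma> j * \<gamma> j * x"
    by (metis x mult.assoc)
  with x show ?thesis
    unfolding E_poly[OF assms(1,2)] E_poly[OF assms(3,4)] by (simp add: algebra_simps)
qed

lemma far_comm:
  assumes "1 \<le> i" "i < n" "1 \<le> j" "j < n" "Suc i < j \<or> Suc j < i"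
  shows "\<gamma> i * \<gamma> j = \<gamma> j * \<gamma> i" "\<epsilon> i * \<gamma> j = \<gamma> j * \<epsilon> i"
proof -
  show 1: "\<gamma> i * \<gamma> j = \<gamma> j * \<gamma> i" using assms GG_comm[of i j] GG_comm[of j i] by auto
  show "\<epsilon> i * \<gamma> j = \<gamma> j * \<epsilon> i"
    using E_intertwine[of i i "\<gamma> j"] assms 1 by simp
qed

text \<open>The mirror images of the two cubic relations between the \<open>g\<close> and the \<open>e\<close>: the element
  \<open>g\<^sub>i g\<^sub>i\<^sub>+\<^sub>1\<close> conjugates \<open>e\<^sub>i\<close> to \<open>e\<^sub>i\<^sub>+\<^sub>1\<close>. They make the defining relations stable under reversal of words.\<close>

lemma EGG:
  assumes "1 \<le> i" "Suc i < n"
  shows "\<epsilon> (Suc i) * \<gamma> i * \<gamma> (Suc i) = \<epsilon> (Suc i) * \<epsilon> i"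
    and "\<epsilon> i * \<gamma> (Suc i) * \<gamma> i = \<epsilon> i * \<epsilon> (Suc i)"
proof -
  have "\<gamma> i * \<gamma> (Suc i) * \<epsilon> i = \<epsilon> (Suc i) * (\<gamma> i * \<gamma> (Suc i))"
    by (rule E_intertwine) (use assms braid in \<open>auto simp: mult.assoc\<close>)
  then show "\<epsilon> (Suc i) * \<gamma> i * \<gamma> (Suc i) = \<epsilon> (Suc i) * \<epsilon> i"
    using GGE[OF assms] by (simp add: mult.assoc)
  have "\<gamma> (Suc i) * \<gamma> i * \<epsilon> (Suc i) = \<epsilon> i * (\<gamma> (Suc i) * \<gamma> i)"
    by (rule E_intertwine) (use assms braid in \<open>auto simp: mult.assoc\<close>)
  then show "\<epsilon> i * \<gamma> (Suc i) * \<gamma> i = \<epsilon> i * \<epsilon> (Suc i)"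
    using GGE'[OF assms] by (simp add: mult.assoc)
qed

subsection \<open>Vectors on which some generators act by \<open>q\<close>\<close>

definition fixed :: "'a \<Rightarrow> nat \<Rightarrow> bool" where
  "fixed v i \<longleftrightarrow> v * \<gamma> i = q \<cdot> v"

lemma fixed_mult:
  assumes "fixed v i" "x * \<gamma> i = \<gamma> i * x"
  shows "fixed (v * x) i"
proof -
  have "v * x * \<gamma> i = v * \<gamma> i * x" by (simp add: assms(2) mult.assoc)
  then show ?thesis using assms(1) by (simp add: fixed_def)
qed

lemma fixed_smul: "fixed v i \<Longrightarrow> fixed (c \<cdot> v) i"
  by (simp add: fixed_def mult.commute)

text \<open>The eigenvalue of \<open>g\<^sub>i\<close> belonging to \<open>e\<^sub>i\<close> is \<open>r\<^sup>-\<^sup>1\<close>, which differs from \<open>q\<close>.\<close>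

lemma fixed_E:
  assumes "1 \<le> i" "i < n" "fixed v i"
  shows "v * \<epsilon> i = 0"
proof -
  have "v * \<gamma> i * \<epsilon> i = inverse r \<cdot> (v * \<epsilon> i)"
    by (simp add: mult.assoc GE[OF assms(1,2)])
  then have "q \<cdot> (v * \<epsilon> i) = inverse r \<cdot> (v * \<epsilon> i)"
    using assms(3) by (simp add: fixed_def)
  then show ?thesis using inverse_r_neq_q by (metis scale_cancel_right)
qed

lemma fixed_GE:
  assumes "1 \<le> i" "Suc i < n" "fixed v i"
  shows "v * \<gamma> (Suc i) * \<epsilon> i = inverse q \<cdot> (v * \<epsilon> (Suc i) * \<epsilon> i)"
proof -
  have "v * \<epsilon> (Suc i) * \<epsilon> i = v * \<gamma> i * \<gamma> (Suc i) * \<epsilon> i"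
    using GGE[OF assms(1,2)] by (simp add: mult.assoc)
  also have "\<dots> = q \<cdot> (v * \<gamma> (Suc i) * \<epsilon> i)"
    using assms(3) by (simp add: fixed_def)
  finally show ?thesis by simp
qed

text \<open>The identity \<open>e\<^sub>i\<^sub>+\<^sub>1 e\<^sub>i e\<^sub>i\<^sub>+\<^sub>1 = e\<^sub>i\<^sub>+\<^sub>1\<close> itself does not follow from the relations for all parameters: if
  \<open>r = q\<^sup>-\<^sup>1 - q\<close>, they are satisfied by the scalars \<open>g\<^sub>i = r\<^sup>-\<^sup>1\<close>, \<open>e\<^sub>i = r\<^sup>-\<^sup>2\<close>, which violate it. They only give that the
  difference \<open>Z\<close> of its two sides satisfies \<open>Z = - (q - q\<^sup>-\<^sup>1) g\<^sub>i Z\<close>. Behind a vector on which \<open>g\<^sub>i\<close> acts by \<open>q\<close>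
  this says \<open>q\<^sup>2 v Z = 0\<close>.\<close>

lemma fixed_EEE:
  assumes "1 \<le> i" "Suc i < n" "fixed v i"
  shows "v * \<epsilon> (Suc i) * \<epsilon> i * \<epsilon> (Suc i) = v * \<epsilon> (Suc i)"
proof -
  let ?F = "v * \<epsilon> (Suc i) * \<epsilon> i * \<epsilon> (Suc i)"
  have EGE: "\<epsilon> (Suc i) * \<gamma> i * \<epsilon> (Suc i) = r \<cdot> (\<epsilon> (Suc i) * \<epsilon> i * \<epsilon> (Suc i))"
  proof -
    have "\<epsilon> (Suc i) * \<epsilon> i * \<epsilon> (Suc i) = \<epsilon> (Suc i) * \<gamma> (Suc i) * \<gamma> i * \<epsilon> (Suc i)"
      using GGE'[OF assms(1,2)] by (simp add: mult.assoc)
    then show ?thesis using EG[of "Suc i"] assms by simp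
  qed
  have "?F = v * \<gamma> i * \<gamma> (Suc i) * \<epsilon> i * \<epsilon> (Suc i)"
    using GGE[OF assms(1,2)] by (simp add: mult.assoc)
  also have "\<dots> = q \<cdot> (v * \<gamma> (Suc i) * (\<gamma> (Suc i) * \<gamma> i * \<epsilon> (Suc i)))"
    using assms(3) GGE'[OF assms(1,2)] by (simp add: fixed_def mult.assoc)
  also have "\<dots> = q \<cdot> (v * (\<gamma> (Suc i) * \<gamma> (Suc i)) * \<gamma> i * \<epsilon> (Suc i))"
    by (simp add: mult.assoc)
  also have "\<dots> = q \<cdot> (v * \<gamma> i * \<epsilon> (Suc i) + qhat q \<cdot> (v * (\<gamma> (Suc i) * \<gamma> i * \<epsilon> (Suc i)))
      - (inverse r * qhat q) \<cdot> (v * (\<epsilon> (Suc i) * \<gamma> i * \<epsilon> (Suc i))))"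
    using assms by (simp add: quad algebra_simps)
  also have "v * (\<gamma> (Suc i) * \<gamma> i * \<epsilon> (Suc i)) = 0"
    using GGE'[OF assms(1,2)] fixed_E[OF _ _ assms(3)] assms by (simp flip: mult.assoc)
  also have "(inverse r * qhat q) \<cdot> (v * (\<epsilon> (Suc i) * \<gamma> i * \<epsilon> (Suc i))) = qhat q \<cdot> ?F"
    using arg_cong[OF EGE, of "\<lambda>y. v * y"] by (simp add: mult.assoc)
  finally have "?F = (q * q) \<cdot> (v * \<epsilon> (Suc i)) - (q * qhat q) \<cdot> ?F"
    using assms(3) by (simp add: fixed_def scale_right_diff_distrib)
  then have "(1 + q * qhat q) \<cdot> ?F = (q * q) \<cdot> (v * \<epsilon> (Suc i))"
    by (simp add: scale_left_distrib algebra_simps)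
  then show ?thesis unfolding q_qhat by (metis scale_cancel_left mult_eq_0_iff q_nz)
qed

lemma fixed_EEG:
  assumes "1 \<le> i" "Suc i < n" "fixed v i"
  shows "v * \<epsilon> (Suc i) * \<epsilon> i * \<gamma> (Suc i) =
    v * \<epsilon> (Suc i) * \<gamma> i + qhat q \<cdot> (v * \<epsilon> (Suc i) * \<epsilon> i) - qhat q \<cdot> (v * \<epsilon> (Suc i))"
proof -
  have *: "v * \<epsilon> (Suc i) * \<gamma> i * \<gamma> (Suc i) = v * \<epsilon> (Suc i) * \<epsilon> i"
    using EGG(1)[OF assms(1,2)] by (simp add: mult.assoc)
  have "v * \<epsilon> (Suc i) * \<gamma> i * \<epsilon> (Suc i) = r \<cdot> (v * \<epsilon> (Suc i) * \<gamma> (Suc i) * \<gamma> i * \<epsilon> (Suc i))"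
    using EG[of "Suc i"] assms by (simp add: mult.assoc)
  also have "\<dots> = r \<cdot> (v * \<epsilon> (Suc i) * \<epsilon> i * \<epsilon> (Suc i))"
    using GGE'[OF assms(1,2)] by (simp add: mult.assoc)
  finally have **: "v * \<epsilon> (Suc i) * \<gamma> i * \<epsilon> (Suc i) = r \<cdot> (v * \<epsilon> (Suc i))"
    using fixed_EEE[OF assms] by simp
  have "v * \<epsilon> (Suc i) * \<epsilon> i * \<gamma> (Suc i) = v * \<epsilon> (Suc i) * \<gamma> i * (\<gamma> (Suc i) * \<gamma> (Suc i))"
    by (subst *[symmetric]) (simp add: mult.assoc)
  also have "\<dots> = v * \<epsilon> (Suc i) * \<gamma> i + qhat q \<cdot> (v * \<epsilon> (Suc i) * \<gamma> i * \<gamma> (Suc i))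
      - (inverse r * qhat q) \<cdot> (v * \<epsilon> (Suc i) * \<gamma> i * \<epsilon> (Suc i))"
    using assms by (simp add: quad distrib_left right_diff_distrib)
  finally show ?thesis unfolding * ** by simp
qed

lemma fixed_EEE_G:
  assumes "1 \<le> i" "Suc (Suc i) < n" "fixed v i" "fixed v (Suc i)"
  shows "v * \<epsilon> (Suc (Suc i)) * \<epsilon> (Suc i) * \<epsilon> i * \<gamma> (Suc (Suc i)) =
    q \<cdot> (v * \<epsilon> (Suc (Suc i)) * \<epsilon> (Suc i) * \<epsilon> i)"
proof -
  let ?w = "v * \<epsilon> (Suc (Suc i))"
  have w: "fixed ?w i"
    by (rule fixed_mult) (use assms far_comm(2)[of "Suc (Suc i)" i] in auto)
  have "?w * \<epsilon> (Suc i) * \<epsilon> i * \<gamma> (Suc (Suc i)) = ?w * \<epsilon> (Suc i) * \<gamma> (Suc (Suc i)) * \<epsilon> i"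
    using far_comm(2)[of i "Suc (Suc i)"] assms by (simp add: mult.assoc)
  also have "\<dots> = ?w * \<gamma> (Suc i) * \<epsilon> i + qhat q \<cdot> (?w * \<epsilon> (Suc i) * \<epsilon> i) - qhat q \<cdot> (?w * \<epsilon> i)"
    using assms by (simp add: fixed_EEG distrib_right left_diff_distrib)
  also have "\<dots> = (inverse q + qhat q) \<cdot> (?w * \<epsilon> (Suc i) * \<epsilon> i)"
    using fixed_GE[OF _ _ w] fixed_E[OF _ _ w] assms by (simp add: scale_left_distrib)
  finally show ?thesis by (simp add: qhat_def)
qed

subsection \<open>Descending products\<close>

definition gdown :: "nat \<Rightarrow> nat \<Rightarrow> 'a" where
  "gdown a b = prod_list (map \<gamma> (rev [a..<b]))"

definition edown :: "nat \<Rightarrow> nat \<Rightarrow> 'a" where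
  "edown a b = prod_list (map \<epsilon> (rev [a..<b]))"

lemma down_empty [simp]: "gdown a a = 1" "edown a a = 1"
  by (simp_all add: gdown_def edown_def)

lemma down_split:
  assumes "a \<le> c" "c \<le> b"
  shows "gdown a b = gdown c b * gdown a c" "edown a b = edown c b * edown a c"
  using upt_add_eq_append[of a c "b - c"] assms by (simp_all add: gdown_def edown_def)

lemma down_single [simp]: "gdown a (Suc a) = \<gamma> a" "edown a (Suc a) = \<epsilon> a"
  by (simp_all add: gdown_def edown_def)

lemma down_top:
  assumes "a \<le> b"
  shows "gdown a (Suc b) = \<gamma> b * gdown a b" "edown a (Suc b) = \<epsilon> b * edown a b"
  using down_split[of a b "Suc b"] assms by simp_all

lemma down_bottom:
  assumes "a < b"
  shows "gdown a b = gdown (Suc a) b * \<gamma> a" "edown a b = edown (Suc a) b * \<epsilon> a"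
  using down_split[of a "Suc a" b] assms by simp_all

lemma down_far:
  assumes "1 \<le> a" "b \<le> n" "1 \<le> m" "m < n" "Suc m < a \<or> b < m"
  shows "gdown a b * \<gamma> m = \<gamma> m * gdown a b" "edown a b * \<gamma> m = \<gamma> m * edown a b"
proof -
  have *: "prod_list (map f xs) * y = y * prod_list (map f xs)"
    if "\<And>i. i \<in> set xs \<Longrightarrow> f i * y = y * f i" for f and xs :: "nat list" and y :: 'a
    using that by (induction xs) (simp_all, metis mult.assoc)
  show "gdown a b * \<gamma> m = \<gamma> m * gdown a b" "edown a b * \<gamma> m = \<gamma> m * edown a b"
    unfolding gdown_def edown_def
    by (rule *, rule far_comm; use assms in auto)+
qed

lemma gdown_shift:
  assumes "1 \<le> a" "a \<le> m" "Suc m < b" "b \<le> n"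
  shows "gdown a b * \<gamma> (Suc m) = \<gamma> m * gdown a b"
proof -
  have "gdown a b = gdown (Suc (Suc m)) b * \<gamma> (Suc m) * \<gamma> m * gdown a m"
    using assms by (simp add: down_split[of a "Suc (Suc m)" b] down_top mult.assoc)
  then have "gdown a b * \<gamma> (Suc m) =
      gdown (Suc (Suc m)) b * (\<gamma> (Suc m) * \<gamma> m * \<gamma> (Suc m)) * gdown a m"
    using down_far(1)[of a m "Suc m"] assms by (simp add: mult.assoc)
  also have "\<dots> = gdown (Suc (Suc m)) b * \<gamma> m * \<gamma> (Suc m) * \<gamma> m * gdown a m"
    using braid[of m] assms by (simp add: mult.assoc)
  also have "\<dots> = \<gamma> m * gdown (Suc (Suc m)) b * \<gamma> (Suc m) * \<gamma> m * gdown a m"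
    using down_far(1)[of "Suc (Suc m)" b m] assms by simp
  also have "\<dots> = \<gamma> m * gdown a b"
    using assms by (simp add: down_split[of a "Suc (Suc m)" b] down_top mult.assoc)
  finally show ?thesis .
qed

lemma fixed_gdown:
  assumes "p \<le> i" "\<And>m. \<lbrakk>p \<le> m; m < i\<rbrakk> \<Longrightarrow> fixed v m"
  shows "v * gdown p i = q ^ (i - p) \<cdot> v"
  using assms
proof (induction i rule: dec_induct)
  case (step i)
  have "v * gdown p (Suc i) = q \<cdot> (v * gdown p i)"
    using step.hyps step.prems[of i]
    by (simp add: down_top fixed_def flip: mult.assoc)
  with step show ?case by (simp add: Suc_diff_le)
qed simp

text \<open>Repeated use of \<open>g\<^sub>i\<^sub>+\<^sub>1 e\<^sub>i = g\<^sub>i\<^sup>-\<^sup>1 e\<^sub>i\<^sub>+\<^sub>1 e\<^sub>i\<close>: the inverse \<open>g\<^sub>i\<^sup>-\<^sup>1\<close> commutes with the factors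
  to its left and acts on \<open>v\<close> as \<open>q\<^sup>-\<^sup>1\<close>. These are the correction terms that the \<open>e\<close> in the quadratic relation produces.\<close>

lemma gdown_E:
  assumes "1 \<le> p" "p \<le> b" "b < n" "\<And>m. \<lbrakk>p \<le> m; m < b\<rbrakk> \<Longrightarrow> fixed v m"
  shows "v * gdown (Suc p) (Suc b) * \<epsilon> p = inverse q ^ (b - p) \<cdot> (v * edown p (Suc b))"
  using assms(2,1,4)
proof (induction p rule: inc_induct)
  case (step p)
  let ?w = "v * gdown (Suc (Suc p)) (Suc b)"
  have w: "fixed ?w p"
    by (rule fixed_mult) (use step.hyps step.prems assms(3) in \<open>auto intro!: down_far\<close>)
  have "v * gdown (Suc p) (Suc b) * \<epsilon> p = ?w * \<gamma> (Suc p) * \<epsilon> p"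
    using step.hyps by (simp add: down_bottom(1)[of "Suc p"] mult.assoc)
  also have "\<dots> = inverse q \<cdot> (?w * \<epsilon> (Suc p) * \<epsilon> p)"
    by (rule fixed_GE) (use w step assms(3) in auto)
  also have "?w * \<epsilon> (Suc p) = inverse q ^ (b - Suc p) \<cdot> (v * edown (Suc p) (Suc b))"
    using step by simp
  finally show ?case
    using step.hyps
    by (simp add: down_bottom(2)[of p] mult.assoc Suc_diff_Suc flip: power_Suc)
qed simp

subsection \<open>The right module generated by a vector that is fixed below \<open>k\<close>\<close>

context
  fixes S :: 'a and k :: nat
  assumes S_fixed: "\<And>i. \<lbrakk>1 \<le> i; i < k\<rbrakk> \<Longrightarrow> fixed S i" and k_less: "k < n"
begin

definition gvec :: "nat \<Rightarrow> 'a" where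
  "gvec p = S * gdown p (Suc k)"

definition evec :: "nat \<Rightarrow> nat \<Rightarrow> 'a" where
  "evec i p = S * edown i (Suc k) * gdown p i"

lemma fixed_edown:
  assumes "1 \<le> m" "Suc m < i" "i \<le> Suc k"
  shows "fixed (S * edown i (Suc k)) m"
  by (rule fixed_mult[OF S_fixed]) (use assms k_less in \<open>auto intro!: down_far\<close>)

lemma gvec_far:
  assumes "1 \<le> p" "p \<le> Suc k" "1 \<le> m" "m \<le> k" "m \<noteq> p" "Suc m \<noteq> p"
  shows "gvec p * \<gamma> m = q \<cdot> gvec p"
proof (cases "m < p")
  case True
  then have "fixed (gvec p) m" unfolding gvec_def
    by (intro fixed_mult S_fixed) (use assms k_less in \<open>auto intro!: down_far\<close>)
  then show ?thesis by (simp add: fixed_def)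
next
  case False
  then obtain m' where m': "m = Suc m'" "p \<le> m'"
    using assms by (cases m) auto
  have "gvec p * \<gamma> m = S * \<gamma> m' * gdown p (Suc k)"
    using gdown_shift[of p m' "Suc k"] assms m' k_less by (simp add: gvec_def mult.assoc)
  then show ?thesis
    using S_fixed[of m'] assms m' by (simp add: fixed_def gvec_def)
qed

lemma gvec_same:
  assumes "1 \<le> m" "m \<le> k"
  shows "gvec m * \<gamma> m = gvec (Suc m) + qhat q \<cdot> gvec m
    - (inverse r * qhat q * inverse q ^ (k - m)) \<cdot> evec m m"
proof -
  have m: "gvec m = gvec (Suc m) * \<gamma> m"
    using assms by (simp add: gvec_def down_bottom(1)[of m] mult.assoc)
  have "gvec (Suc m) * \<epsilon> m = inverse q ^ (k - m) \<cdot> evec m m"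
    using gdown_E[of m k S] S_fixed assms k_less by (simp add: gvec_def evec_def)
  moreover have "gvec m * \<gamma> m = gvec (Suc m) * (\<gamma> m * \<gamma> m)"
    by (simp add: m mult.assoc)
  ultimately show ?thesis
    using assms k_less by (simp add: quad m right_diff_distrib distrib_left)
qed

lemma gvec_above:
  assumes "m \<le> k"
  shows "gvec (Suc m) * \<gamma> m = gvec m"
  using assms by (simp add: gvec_def down_bottom(1)[of m] mult.assoc)

lemma evec_above:
  assumes "m < i"
  shows "evec i (Suc m) * \<gamma> m = evec i m"
  using assms by (simp add: evec_def down_bottom(1)[of m] mult.assoc)

lemma evec_bottom:
  assumes "1 \<le> m" "m < i" "i \<le> k"
  shows "evec i m * \<gamma> m = evec i (Suc m) + qhat q \<cdot> evec i m
    - (inverse r * qhat q * inverse q ^ (i - Suc m)) \<cdot> evec m m"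
proof -
  obtain b where i: "i = Suc b" using assms by (cases i) auto
  have m: "evec i m = evec i (Suc m) * \<gamma> m"
    using assms by (simp add: evec_above)
  have "evec i (Suc m) * \<epsilon> m = inverse q ^ (b - m) \<cdot> (S * edown i (Suc k) * edown m (Suc b))"
    unfolding evec_def i
    by (rule gdown_E) (use assms k_less i in \<open>auto intro!: fixed_edown\<close>)
  also have "S * edown i (Suc k) * edown m (Suc b) = evec m m"
    using assms i by (simp add: evec_def down_split(2)[of m i "Suc k"] mult.assoc)
  finally have "evec i (Suc m) * \<epsilon> m = inverse q ^ (i - Suc m) \<cdot> evec m m"
    by (simp add: i)
  moreover have "evec i m * \<gamma> m = evec i (Suc m) * (\<gamma> m * \<gamma> m)"
    by (simp add: m mult.assoc)
  ultimately show ?thesis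
    using assms k_less by (simp add: quad m right_diff_distrib distrib_left)
qed

lemma evec_same:
  assumes "1 \<le> m" "m \<le> k"
  shows "evec m m * \<gamma> m = inverse r \<cdot> evec m m"
  using assms k_less by (simp add: evec_def down_bottom(2)[of m] EG mult.assoc)

lemma evec_top:
  assumes "1 \<le> p" "p \<le> j" "Suc j \<le> k"
  shows "evec (Suc j) p * \<gamma> (Suc j) = evec j p"
proof -
  have "evec (Suc j) p * \<gamma> (Suc j) =
      S * edown (Suc (Suc j)) (Suc k) * (\<epsilon> (Suc j) * \<gamma> j * \<gamma> (Suc j)) * gdown p j"
    using down_far(1)[of p j "Suc j"] assms k_less
    by (simp add: evec_def down_bottom(2)[of "Suc j"] down_top(1) mult.assoc)
  also have "\<epsilon> (Suc j) * \<gamma> j * \<gamma> (Suc j) = \<epsilon> (Suc j) * \<epsilon> j"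
    by (rule EGG) (use assms k_less in auto)
  also have "S * edown (Suc (Suc j)) (Suc k) * (\<epsilon> (Suc j) * \<epsilon> j) * gdown p j = evec j p"
    using assms
    by (simp add: evec_def down_bottom(2)[of "Suc j"] down_bottom(2)[of j] mult.assoc)
  finally show ?thesis .
qed

lemma evec_below:
  assumes "1 \<le> p" "p \<le> j" "Suc j \<le> k"
  shows "evec j p * \<gamma> (Suc j) = evec (Suc j) p + qhat q \<cdot> evec j p
    - (qhat q * q ^ (j - p)) \<cdot> evec (Suc j) (Suc j)"
proof -
  let ?v = "S * edown (Suc (Suc j)) (Suc k)"
  have v: "fixed ?v j" by (rule fixed_edown) (use assms in auto)
  have "S * edown (Suc j) (Suc k) * gdown p j = q ^ (j - p) \<cdot> (S * edown (Suc j) (Suc k))"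
    by (rule fixed_gdown) (use assms in \<open>auto intro!: fixed_edown\<close>)
  then have E: "?v * \<epsilon> (Suc j) * gdown p j = q ^ (j - p) \<cdot> evec (Suc j) (Suc j)"
    using assms by (simp add: evec_def down_bottom(2)[of "Suc j"] mult.assoc)
  have "evec j p * \<gamma> (Suc j) = ?v * \<epsilon> (Suc j) * \<epsilon> j * \<gamma> (Suc j) * gdown p j"
    using down_far(1)[of p j "Suc j"] assms k_less
    by (simp add: evec_def down_bottom(2)[of "Suc j"] down_bottom(2)[of j] mult.assoc)
  also have "\<dots> = ?v * \<epsilon> (Suc j) * \<gamma> j * gdown p j
      + qhat q \<cdot> (?v * \<epsilon> (Suc j) * \<epsilon> j * gdown p j) - qhat q \<cdot> (?v * \<epsilon> (Suc j) * gdown p j)"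
    using fixed_EEG[OF _ _ v] assms k_less by (simp add: distrib_right left_diff_distrib)
  also have "?v * \<epsilon> (Suc j) * \<gamma> j * gdown p j = evec (Suc j) p"
    using assms by (simp add: evec_def down_bottom(2)[of "Suc j"] down_top(1) mult.assoc)
  also have "?v * \<epsilon> (Suc j) * \<epsilon> j * gdown p j = evec j p"
    using assms
    by (simp add: evec_def down_bottom(2)[of "Suc j"] down_bottom(2)[of j] mult.assoc)
  finally show ?thesis by (simp add: E)
qed

lemma evec_far:
  assumes "1 \<le> p" "p \<le> i" "i \<le> k" "1 \<le> m" "m \<le> k"
    and "m \<noteq> p" "Suc m \<noteq> p" "m \<noteq> i" "m \<noteq> Suc i"
  shows "evec i p * \<gamma> m = q \<cdot> evec i p"
proof -
  consider "Suc m < p" | "p < m" "m < i" | "Suc i < m"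
    using assms by linarith
  then show ?thesis
  proof cases
    case 1
    then have "fixed (evec i p) m" unfolding evec_def
      by (intro fixed_mult[OF fixed_edown]) (use assms k_less 1 in \<open>auto intro!: down_far\<close>)
    then show ?thesis by (simp add: fixed_def)
  next
    case 2
    then obtain m' where m': "m = Suc m'" "p \<le> m'"
      by (cases m) auto
    have "evec i p * \<gamma> m = S * edown i (Suc k) * \<gamma> m' * gdown p i"
      using gdown_shift[of p m' i] assms 2 m' k_less by (simp add: evec_def mult.assoc)
    then show ?thesis
      using fixed_edown[of m' i] assms 2 m' by (simp add: fixed_def evec_def)
  next
    case 3
    then obtain j where j: "m = Suc (Suc j)" "i \<le> j"
      by (cases m; cases "m - 1") auto
    let ?v = "S * edown (Suc m) (Suc k)"
    let ?w = "?v * \<epsilon> (Suc (Suc j)) * \<epsilon> (Suc j) * \<epsilon> j"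
    have ev: "evec i p = ?w * edown i j * gdown p i"
    proof -
      have "edown i (Suc k) = edown (Suc m) (Suc k) * edown i (Suc m)"
        by (rule down_split) (use assms 3 in auto)
      moreover have "edown i (Suc m) = \<epsilon> (Suc (Suc j)) * \<epsilon> (Suc j) * \<epsilon> j * edown i j"
        using j by (simp add: down_top mult.assoc)
      ultimately show ?thesis by (simp add: evec_def mult.assoc)
    qed
    have "evec i p * \<gamma> m = ?w * \<gamma> (Suc (Suc j)) * edown i j * gdown p i"
      using down_far(1)[of p i m] down_far(2)[of i j m] assms j k_less
      by (simp add: ev mult.assoc) (simp flip: mult.assoc)
    also have "?w * \<gamma> (Suc (Suc j)) = q \<cdot> ?w"
      by (rule fixed_EEE_G) (use assms j k_less in \<open>auto intro!: fixed_edown\<close>)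
    finally show ?thesis by (simp add: ev)
  qed
qed

text \<open>The coefficients of the vectors \<open>evec i p\<close> in \<open>S b\<^sub>k\<^sub>,\<^sub>1\<close>.\<close>

definition weight :: "nat \<Rightarrow> nat \<Rightarrow> complex" where
  "weight i p = q ^ (2 * k - 2 * i + 1) * q ^ (i - p)"

lemma S_b_expand:
  "S * ev (\<cdot>) \<gamma> \<epsilon> (b_k1 q r k) = (\<Sum>p=1..Suc k. q ^ (Suc k - p) \<cdot> gvec p)
    + (qhat q / (1 - q powi (2 * int k - 1) * r)) \<cdot> (\<Sum>i=1..k. \<Sum>p=1..i. weight i p \<cdot> evec i p)"
proof -
  have 1: "(\<Sum>i=0..k. q ^ i \<cdot> (S * prod_list (map \<gamma> (rev [Suc k - i..<Suc k]))))
      = (\<Sum>p=1..Suc k. q ^ (Suc k - p) \<cdot> gvec p)"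
    by (rule sum.reindex_bij_witness[of _ "\<lambda>p. Suc k - p" "\<lambda>i. Suc k - i"])
      (auto simp: gvec_def gdown_def)
  have 2: "(\<Sum>j=0..i-1. q ^ j \<cdot> (S * (edown i (Suc k) * gdown (i - j) i)))
      = (\<Sum>p=1..i. q ^ (i - p) \<cdot> evec i p)" if "1 \<le> i" for i
    by (rule sum.reindex_bij_witness[of _ "\<lambda>p. i - p" "\<lambda>j. i - j"])
      (use that in \<open>auto simp: evec_def mult.assoc\<close>)
  have "S * ev (\<cdot>) \<gamma> \<epsilon> (d q (k + 1) i) = (\<Sum>p=1..i. q ^ (i - p) \<cdot> evec i p)" if "1 \<le> i" for i
    using 2[OF that] by (simp add: d_def sum_distrib_left edown_def gdown_def del: upt_Suc)
  then show ?thesis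
    using 1 by (simp add: b_k1_def distrib_left sum_distrib_left weight_def scale_sum_right mult_ac del: upt_Suc)
qed

context
  fixes m :: nat
  assumes m: "1 \<le> m" "m \<le> k"
begin

text \<open>The defect of the \<open>i\<close>-th row of the triangular sum over \<open>p \<le> i\<close>. By \<open>evec_far\<close> only the entries with
  \<open>p \<in> {m, m + 1}\<close> and the rows \<open>m - 1\<close> and \<open>m\<close> contribute.\<close>

definition row :: "nat \<Rightarrow> 'a" where
  "row i = (\<Sum>p=1..i. weight i p \<cdot> (evec i p * \<gamma> m - q \<cdot> evec i p))"

text \<open>The pattern of both cancellations: \<open>x\<close> and \<open>y\<close> are neighbours interchanged by \<open>g\<^sub>m\<close>, with weights in the ratio \<open>q\<close>,
  and \<open>z\<close> is the correction term.\<close>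

lemma telescope:
  "(q * c) \<cdot> (x - inverse q \<cdot> y - a \<cdot> z) + c \<cdot> (y - q \<cdot> x) = - ((q * c * a) \<cdot> z)"
proof -
  have "q * c * inverse q = c" by simp
  then show ?thesis by (simp add: scale_right_diff_distrib mult.commute[of c q])
qed

lemma gvec_defect:
  "(\<Sum>p=1..Suc k. q ^ (Suc k - p) \<cdot> (gvec p * \<gamma> m - q \<cdot> gvec p))
    = - ((inverse r * qhat q * q) \<cdot> evec m m)"
proof -
  let ?Q = "q ^ (k - m)"
  have "(\<Sum>p=1..Suc k. q ^ (Suc k - p) \<cdot> (gvec p * \<gamma> m - q \<cdot> gvec p))
      = (\<Sum>p\<in>{m, Suc m}. q ^ (Suc k - p) \<cdot> (gvec p * \<gamma> m - q \<cdot> gvec p))"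
    by (rule sum.mono_neutral_right) (use m gvec_far in auto)
  also have "\<dots> = (q * ?Q) \<cdot> (gvec m * \<gamma> m - q \<cdot> gvec m)
      + ?Q \<cdot> (gvec (Suc m) * \<gamma> m - q \<cdot> gvec (Suc m))"
    using m by (simp add: Suc_diff_le)
  also have "gvec m * \<gamma> m - q \<cdot> gvec m =
      gvec (Suc m) - inverse q \<cdot> gvec m - (inverse r * qhat q * inverse ?Q) \<cdot> evec m m"
    using m by (simp add: gvec_same qhat_def scale_left_diff_distrib power_inverse)
  also have "(q * ?Q) \<cdot> \<dots> + ?Q \<cdot> (gvec (Suc m) * \<gamma> m - q \<cdot> gvec (Suc m))
      = - ((inverse r * qhat q * q) \<cdot> evec m m)"
    unfolding gvec_above[OF m(2)] telescope by (simp add: field_simps)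
  finally show ?thesis .
qed

lemma row_above:
  assumes "m < i" "i \<le> k"
  shows "row i = - ((inverse r * qhat q * q * q * q ^ (2 * (k - i))) \<cdot> evec m m)"
proof -
  let ?P = "q ^ (i - Suc m)" and ?R = "q ^ (2 * (k - i))"
  have "q ^ (i - m) = q * ?P"
    using assms by (simp add: Suc_diff_Suc flip: power_Suc)
  then have w: "weight i m = q * q * ?R * ?P" "weight i (Suc m) = q * ?R * ?P"
    by (simp_all add: weight_def diff_mult_distrib2)
  have "row i = (\<Sum>p\<in>{m, Suc m}. weight i p \<cdot> (evec i p * \<gamma> m - q \<cdot> evec i p))"
    unfolding row_def
    by (rule sum.mono_neutral_right) (use m assms evec_far in auto)
  also have "\<dots> = weight i m \<cdot> (evec i m * \<gamma> m - q \<cdot> evec i m)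
      + weight i (Suc m) \<cdot> (evec i (Suc m) * \<gamma> m - q \<cdot> evec i (Suc m))"
    by simp
  also have "evec i m * \<gamma> m - q \<cdot> evec i m =
      evec i (Suc m) - inverse q \<cdot> evec i m - (inverse r * qhat q * inverse ?P) \<cdot> evec m m"
    using m assms by (simp add: evec_bottom qhat_def scale_left_diff_distrib power_inverse)
  also have "weight i m = q * weight i (Suc m)"
    by (simp add: w)
  also have "evec i (Suc m) * \<gamma> m = evec i m"
    by (rule evec_above) (fact assms)
  finally show ?thesis
    unfolding telescope by (simp add: w field_simps)
qed

text \<open>Right multiplication by \<open>g\<^sub>m\<close> interchanges rows \<open>m - 1\<close> and \<open>m\<close>, so they telescope against each other
  entry by entry; only \<open>evec m m\<close>, which has no partner, and the correction terms survive.\<close>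

lemma rows_near:
  assumes mj: "m = Suc j"
  shows "row j + row m = (q ^ (2 * (k - m)) * (q * (inverse r - q) - q * q * (q ^ (2 * j) - 1))) \<cdot> evec m m"
proof -
  let ?R = "q ^ (2 * (k - m))"
  have w: "weight m p = q * ?R * q ^ (Suc j - p)" "weight j p = q * q * ?R * q ^ (Suc j - p)"
    if "p \<le> j" for p
  proof -
    have "2 * k - 2 * j + 1 = 2 + (2 * (k - m) + 1)" using m mj by linarith
    then show "weight m p = q * ?R * q ^ (Suc j - p)" "weight j p = q * q * ?R * q ^ (Suc j - p)"
      using that by (simp_all add: weight_def mj diff_mult_distrib2 Suc_diff_le)
  qed
  have cell: "weight j p \<cdot> (evec j p * \<gamma> m - q \<cdot> evec j p)
      + weight m p \<cdot> (evec m p * \<gamma> m - q \<cdot> evec m p)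
      = - ((q * q * q * ?R * qhat q * q ^ (2 * (j - p))) \<cdot> evec m m)"
    if "p \<in> {1..j}" for p
  proof -
    have "evec j p * \<gamma> m - q \<cdot> evec j p =
        evec m p - inverse q \<cdot> evec j p - (qhat q * q ^ (j - p)) \<cdot> evec m m"
      using m mj that by (simp add: evec_below qhat_def scale_left_diff_distrib)
    moreover have "evec m p * \<gamma> m = evec j p"
      using m mj that by (simp add: evec_top)
    moreover have "q ^ (2 * (j - p)) = q ^ (j - p) * q ^ (j - p)"
      by (simp add: mult_2 power_add)
    ultimately show ?thesis
      using that by (simp add: w Suc_diff_le scale_right_diff_distrib mult_ac)
  qed
  have "row m = (\<Sum>p=1..j. weight m p \<cdot> (evec m p * \<gamma> m - q \<cdot> evec m p))
      + weight m m \<cdot> (evec m m * \<gamma> m - q \<cdot> evec m m)"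
    unfolding row_def using mj by simp
  also have "weight m m \<cdot> (evec m m * \<gamma> m - q \<cdot> evec m m) = (?R * (q * (inverse r - q))) \<cdot> evec m m"
    using m by (simp add: weight_def evec_same diff_mult_distrib2 flip: scale_left_diff_distrib)
  finally have "row j + row m = (\<Sum>p=1..j. weight j p \<cdot> (evec j p * \<gamma> m - q \<cdot> evec j p)
      + weight m p \<cdot> (evec m p * \<gamma> m - q \<cdot> evec m p)) + (?R * (q * (inverse r - q))) \<cdot> evec m m"
    by (simp add: row_def sum.distrib add.assoc)
  also have "\<dots> = - ((q * q * q * ?R * qhat q * (\<Sum>p=1..j. q ^ (2 * (j - p)))) \<cdot> evec m m)
      + (?R * (q * (inverse r - q))) \<cdot> evec m m"
    by (simp only: sum.cong[OF refl cell] sum_negf scale_sum_left sum_distrib_left)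
  also have "(\<Sum>p=1..j. q ^ (2 * (j - p))) = (\<Sum>s<j. q ^ (2 * s))"
    by (rule sum.reindex_bij_witness[of _ "\<lambda>s. j - s" "\<lambda>p. j - p"]) auto
  also have "q * q * q * ?R * qhat q * (\<Sum>s<j. q ^ (2 * s)) = ?R * (q * q * (q ^ (2 * j) - 1))"
    using arg_cong[OF qhat_geometric[of j], of "\<lambda>x. ?R * (q * q * x)"] by (simp only: mult_ac)
  finally show ?thesis
    by (simp add: right_diff_distrib scale_left_diff_distrib)
qed

lemma row_below: "row i = 0" if "Suc i < m"
  unfolding row_def by (rule sum.neutral) (use that m evec_far in auto)

lemma evec_defect:
  "(\<Sum>i=1..k. row i) = (inverse r * q - q ^ (2 * k)) \<cdot> evec m m"
proof -
  obtain j where mj: "m = Suc j" using m by (cases m) auto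
  let ?N = "k - m"
  have "(\<Sum>i=1..k. row i) = (\<Sum>i<Suc k. row i)"
  proof -
    \<comment> \<open>Row \<open>0\<close> is empty; including it avoids a case distinction for \<open>m = 1\<close>.\<close>
    have "{..<Suc k} = insert 0 {1..k}" by auto
    then show ?thesis by (simp add: row_def)
  qed
  also have "{..<Suc k} = {..<j} \<union> {j, m} \<union> {m<..k}" using m mj by auto
  also have "(\<Sum>i\<in>{..<j} \<union> {j, m} \<union> {m<..k}. row i) = (row j + row m) + (\<Sum>i\<in>{m<..k}. row i)"
    using row_below mj by (subst sum.union_disjoint; auto simp: sum.union_disjoint)+
  also have "(\<Sum>i\<in>{m<..k}. row i) =
      - ((inverse r * qhat q * q * q * (\<Sum>i\<in>{m<..k}. q ^ (2 * (k - i)))) \<cdot> evec m m)"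
    by (simp add: row_above sum_negf scale_sum_left sum_distrib_left)
  also have "(\<Sum>i\<in>{m<..k}. q ^ (2 * (k - i))) = (\<Sum>s<?N. q ^ (2 * s))"
    by (rule sum.reindex_bij_witness[of _ "\<lambda>s. k - s" "\<lambda>i. k - i"]) auto
  also have "inverse r * qhat q * q * q * (\<Sum>s<?N. q ^ (2 * s)) = inverse r * q * (q ^ (2 * ?N) - 1)"
    using arg_cong[OF qhat_geometric[of ?N], of "\<lambda>x. inverse r * q * x"] by (simp only: mult_ac)
  also have "row j + row m + - ((inverse r * q * (q ^ (2 * ?N) - 1)) \<cdot> evec m m)
      = (inverse r * q - q ^ (2 * k)) \<cdot> evec m m"
  proof -
    have "2 * k = 2 + (2 * ?N + 2 * j)" using m mj by linarith
    then have "q ^ (2 * k) = q * q * (q ^ (2 * ?N) * q ^ (2 * j))"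
      by (simp only: power_add power2_eq_square)
    then show ?thesis
      unfolding rows_near[OF mj] by (simp add: algebra_simps flip: scale_left_diff_distrib)
  qed
  finally show ?thesis by simp
qed

end

theorem fixed_S_b:
  assumes m: "1 \<le> m" "m \<le> k"
  shows "fixed (S * ev (\<cdot>) \<gamma> \<epsilon> (b_k1 q r k)) m"
proof -
  let ?c = "qhat q / (1 - q powi (2 * int k - 1) * r)"
  let ?X = "\<Sum>p=1..Suc k. q ^ (Suc k - p) \<cdot> gvec p"
  let ?Y = "\<Sum>i=1..k. \<Sum>p=1..i. weight i p \<cdot> evec i p"
  have X: "(\<Sum>p=1..Suc k. q ^ (Suc k - p) \<cdot> (gvec p * \<gamma> m - q \<cdot> gvec p)) = ?X * \<gamma> m - q \<cdot> ?X"
    by (simp add: scale_right_diff_distrib sum_subtractf sum_distrib_right scale_sum_right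
        scale_right_distrib distrib_right mult_ac)
  have Y: "(\<Sum>i=1..k. row m i) = ?Y * \<gamma> m - q \<cdot> ?Y"
    by (simp add: row_def[OF m] scale_right_diff_distrib sum_subtractf sum_distrib_right
        scale_sum_right mult_ac)
  have "S * ev (\<cdot>) \<gamma> \<epsilon> (b_k1 q r k) * \<gamma> m - q \<cdot> (S * ev (\<cdot>) \<gamma> \<epsilon> (b_k1 q r k))
      = ?X * \<gamma> m - q \<cdot> ?X + ?c \<cdot> (?Y * \<gamma> m - q \<cdot> ?Y)"
    unfolding S_b_expand
    by (simp add: distrib_right scale_right_distrib scale_right_diff_distrib mult.commute
        del: sum.cl_ivl_Suc)
  also have "\<dots> = (?c * (inverse r * q - q ^ (2 * k)) - inverse r * qhat q * q) \<cdot> evec m m"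
    unfolding X[symmetric] Y[symmetric] gvec_defect[OF m] evec_defect[OF m] by (subst scale_left_diff_distrib) simp
  also have "?c * (inverse r * q - q ^ (2 * k)) = inverse r * qhat q * q"
  proof -
    have "inverse r * q - q ^ (2 * k) = inverse r * q * (1 - q ^ (2 * k) / q * r)"
      by (simp add: field_simps)
    then show ?thesis
      using coefficient_denominator[of k] m by simp
  qed
  finally show ?thesis by (simp add: fixed_def)
qed

end

end

section \<open>The opposite algebra\<close>

text \<open>Statements about left multiplication are obtained from those about right multiplication by applying them to
  the same elements in the opposite ring.\<close>

typedef (overloaded) 'a opposite = "UNIV :: 'a::{ring,monoid_mult} set"
  morphisms of_opp to_opp ..

declare of_opp_inverse [simp] to_opp_inverse [OF UNIV_I, simp] of_opp_inject [simp]

instantiation opposite :: ("{ring,monoid_mult}") "{ring,monoid_mult}"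
begin

definition "0 = to_opp 0"
definition "1 = to_opp 1"
definition "x + y = to_opp (of_opp x + of_opp y)"
definition "x - y = to_opp (of_opp x - of_opp y)"
definition "- x = to_opp (- of_opp x)"
definition "x * y = to_opp (of_opp y * of_opp x)"

lemma of_opp_simps [simp]:
  "of_opp 0 = 0" "of_opp 1 = 1" "of_opp (x + y) = of_opp x + of_opp y"
  "of_opp (x - y) = of_opp x - of_opp y" "of_opp (- x) = - of_opp x"
  "of_opp (x * y) = of_opp y * of_opp x"
  by (simp_all add: zero_opposite_def one_opposite_def plus_opposite_def minus_opposite_def
      uminus_opposite_def times_opposite_def)

instance
  by standard (simp_all add: algebra_simps flip: of_opp_inject)

end

lemma of_opp_sum: "of_opp (sum f A) = (\<Sum>x\<in>A. of_opp (f x))"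
  by (induction A rule: infinite_finite_induct) simp_all

lemma of_opp_prod_list: "of_opp (prod_list (map f xs)) = prod_list (map (of_opp \<circ> f) (rev xs))"
  by (induction xs) simp_all

context complex_algebra
begin

definition smul_opp :: "complex \<Rightarrow> 'a opposite \<Rightarrow> 'a opposite" where
  "smul_opp c x = to_opp (c \<cdot> of_opp x)"

lemma of_opp_smul [simp]: "of_opp (smul_opp c x) = c \<cdot> of_opp x"
  by (simp add: smul_opp_def)

lemma complex_algebra_opposite: "complex_algebra smul_opp"
  by unfold_locales
    (simp_all add: scale_right_distrib scale_left_distrib flip: of_opp_inject)

lemma of_opp_ev_b:
  "of_opp (ev smul_opp (to_opp \<circ> \<gamma>) (to_opp \<circ> \<epsilon>) (b_k1 q r k)) = ev (\<cdot>) \<gamma> \<epsilon> (a_k1 q r k)"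
proof -
  interpret opp: complex_algebra smul_opp by (rule complex_algebra_opposite)
  show ?thesis
    by (simp add: b_k1_def a_k1_def d_def dbar_def of_opp_sum of_opp_prod_list comp_def
        del: upt_Suc)
qed

end

context bwm_rep
begin

lemma opposite_rep: "bwm_rep smul_opp q r (to_opp \<circ> \<gamma>) (to_opp \<circ> \<epsilon>) n"
proof -
  interpret opp: complex_algebra smul_opp by (rule complex_algebra_opposite)
  show ?thesis
    by unfold_locales
      (simp_all add: braid GG_comm quad GE EG EGG flip: of_opp_inject, simp_all add: EGG braid GG_comm[symmetric] flip: mult.assoc)
qed

text \<open>The last two relations are exchanged by \<open>i \<mapsto> n - i\<close>.\<close>

lemma flip_rep: "bwm_rep (\<cdot>) q r (\<gamma> \<circ> (\<lambda>i. n - i)) (\<epsilon> \<circ> (\<lambda>i. n - i)) n"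
proof unfold_locales
  have Suc: "n - i = Suc (n - Suc i)" if "Suc i < n" for i using that by simp
  fix i assume i: "1 \<le> i" "Suc i < n"
  show "(\<gamma> \<circ> (\<lambda>i. n - i)) i * (\<gamma> \<circ> (\<lambda>i. n - i)) (Suc i) * (\<gamma> \<circ> (\<lambda>i. n - i)) i =
      (\<gamma> \<circ> (\<lambda>i. n - i)) (Suc i) * (\<gamma> \<circ> (\<lambda>i. n - i)) i * (\<gamma> \<circ> (\<lambda>i. n - i)) (Suc i)"
    using braid[of "n - Suc i"] i Suc[of i] by simp
  show "(\<gamma> \<circ> (\<lambda>i. n - i)) i * (\<gamma> \<circ> (\<lambda>i. n - i)) (Suc i) * (\<epsilon> \<circ> (\<lambda>i. n - i)) i =
      (\<epsilon> \<circ> (\<lambda>i. n - i)) (Suc i) * (\<epsilon> \<circ> (\<lambda>i. n - i)) i"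
    using GGE'[of "n - Suc i"] i Suc[of i] by simp
  show "(\<gamma> \<circ> (\<lambda>i. n - i)) (Suc i) * (\<gamma> \<circ> (\<lambda>i. n - i)) i * (\<epsilon> \<circ> (\<lambda>i. n - i)) (Suc i) =
      (\<epsilon> \<circ> (\<lambda>i. n - i)) i * (\<epsilon> \<circ> (\<lambda>i. n - i)) (Suc i)"
    using GGE[of "n - Suc i"] i Suc[of i] by simp
next
  fix i j assume "1 \<le> i" "Suc i < j" "j < n"
  then show "(\<gamma> \<circ> (\<lambda>i. n - i)) i * (\<gamma> \<circ> (\<lambda>i. n - i)) j = (\<gamma> \<circ> (\<lambda>i. n - i)) j * (\<gamma> \<circ> (\<lambda>i. n - i)) i"
    using GG_comm[of "n - j" "n - i"] by simp
qed (use quad GE EG in auto)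

lemma shift_rep: "bwm_rep (\<cdot>) q r (\<gamma> \<circ> Suc) (\<epsilon> \<circ> Suc) (n - 1)"
  proof unfold_locales
  fix i j assume "1 \<le> i" "Suc i < j" "j < n - 1"
  then show "(\<gamma> \<circ> Suc) i * (\<gamma> \<circ> Suc) j = (\<gamma> \<circ> Suc) j * (\<gamma> \<circ> Suc) i"
    using GG_comm[of "Suc i" "Suc j"] by simp
qed (simp_all add: braid quad GE EG GGE GGE')

definition lfixed :: "'a \<Rightarrow> nat \<Rightarrow> bool" where
  "lfixed v i \<longleftrightarrow> \<gamma> i * v = q \<cdot> v"

lemma lfixed_opposite: "bwm_rep.fixed smul_opp q (to_opp \<circ> \<gamma>) (to_opp v) i \<longleftrightarrow> lfixed v i"
  unfolding bwm_rep.fixed_def[OF opposite_rep] lfixed_def by (simp flip: of_opp_inject)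

lemma lfixed_E:
  assumes "1 \<le> i" "i < n" "lfixed v i"
  shows "\<epsilon> i * v = 0"
  using bwm_rep.fixed_E[OF opposite_rep assms(1,2), of "to_opp v"] assms(3)
  by (simp add: lfixed_opposite flip: of_opp_inject)

theorem lfixed_a_S:
  assumes "\<And>i. \<lbrakk>1 \<le> i; i < k\<rbrakk> \<Longrightarrow> lfixed S i" "k < n" "1 \<le> m" "m \<le> k"
  shows "lfixed (ev (\<cdot>) \<gamma> \<epsilon> (a_k1 q r k) * S) m"
proof -
  interpret opp: bwm_rep smul_opp q r "to_opp \<circ> \<gamma>" "to_opp \<circ> \<epsilon>" n by (rule opposite_rep)
  have "to_opp S * ev smul_opp (to_opp \<circ> \<gamma>) (to_opp \<circ> \<epsilon>) (b_k1 q r k)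
      = to_opp (ev (\<cdot>) \<gamma> \<epsilon> (a_k1 q r k) * S)"
    by (simp add: of_opp_ev_b flip: of_opp_inject)
  moreover have "opp.fixed (to_opp S * ev smul_opp (to_opp \<circ> \<gamma>) (to_opp \<circ> \<epsilon>) (b_k1 q r k)) m"
    by (rule opp.fixed_S_b) (use assms in \<open>simp_all add: lfixed_opposite\<close>)
  ultimately show ?thesis by (simp add: lfixed_opposite)
qed

end

section \<open>The index-reversing automorphism\<close>

lemma reindex_gs [simp]: "reindex f (gs xs) = gs (map f xs)"
  by (induction xs) (simp_all add: gs_def reindex_mult)

lemma reindex_es [simp]: "reindex f (es xs) = es (map f xs)"
  by (induction xs) (simp_all add: es_def reindex_mult)

lemma map_diff_rev_upt:
  assumes "a \<le> b" "b \<le> Suc c"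
  shows "map (\<lambda>i. c - i) (rev [a..<b]) = [Suc c - b..<Suc c - a]"
  by (rule nth_equalityI) (use assms in \<open>auto simp: rev_nth simp del: upt_Suc\<close>)

lemma map_diff_upt:
  assumes "a \<le> b" "b \<le> Suc c"
  shows "map (\<lambda>i. c - i) [a..<b] = rev [Suc c - b..<Suc c - a]"
  using map_diff_rev_upt[OF assms] by (metis rev_map rev_rev_ident)

lemma reindex_b: "reindex (\<lambda>i. Suc k - i) (b_k1 q r k) = b_1k q r k"
proof -
  have "reindex (\<lambda>i. Suc k - i) (d q (k + 1) i) = d' q (k + 1) i" if "i \<in> {1..k}" for i
    using that unfolding d_def d'_def
    by (auto simp: reindex_mult reindex_sum map_diff_rev_upt Suc_diff_le simp del: upt_Suc
        intro!: arg_cong2[of _ _ _ _ "(*)"] sum.cong arg_cong[of _ _ gs])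
  then show ?thesis
    by (auto simp: b_k1_def b_1k_def reindex_add reindex_mult reindex_sum map_diff_rev_upt
        simp del: upt_Suc intro!: arg_cong2[of _ _ _ _ "(+)"] sum.cong)
qed

lemma reindex_a: "reindex (\<lambda>i. Suc k - i) (a_k1 q r k) = a_1k q r k"
proof -
  have "reindex (\<lambda>i. Suc k - i) (dbar q (k + 1) i) = dbar' q (k + 1) i" if "i \<in> {1..k}" for i
    using that unfolding dbar_def dbar'_def
    by (auto simp: reindex_mult reindex_sum map_diff_upt Suc_diff_le simp del: upt_Suc
        intro!: arg_cong2[of _ _ _ _ "(*)"] sum.cong arg_cong[of _ _ gs])
  then show ?thesis
    by (auto simp: a_k1_def a_1k_def reindex_add reindex_mult reindex_sum map_diff_upt
        simp del: upt_Suc intro!: arg_cong2[of _ _ _ _ "(+)"] sum.cong)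
qed

context bwm_rep
begin

theorem fixed_S_b':
  assumes "n = Suc k" "\<And>i. \<lbrakk>1 < i; i \<le> k\<rbrakk> \<Longrightarrow> fixed S i" "1 \<le> m" "m \<le> k"
  shows "fixed (S * ev (\<cdot>) \<gamma> \<epsilon> (b_1k q r k)) m"
proof -
  interpret flip: bwm_rep "(\<cdot>)" q r "\<gamma> \<circ> (\<lambda>i. n - i)" "\<epsilon> \<circ> (\<lambda>i. n - i)" n by (rule flip_rep)
  have flip: "flip.fixed v i \<longleftrightarrow> fixed v (n - i)" for v i
    by (simp add: flip.fixed_def fixed_def)
  have "flip.fixed (S * ev (\<cdot>) (\<gamma> \<circ> (\<lambda>i. n - i)) (\<epsilon> \<circ> (\<lambda>i. n - i)) (b_k1 q r k)) (n - m)"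
    by (rule flip.fixed_S_b) (use assms in \<open>auto simp: flip[unfolded assms(1)]\<close>)
  then show ?thesis
    using assms reindex_b[of k q r] by (simp add: flip[unfolded assms(1)] flip: ev_reindex)
qed

theorem lfixed_a_S':
  assumes "n = Suc k" "\<And>i. \<lbrakk>1 < i; i \<le> k\<rbrakk> \<Longrightarrow> lfixed S i" "1 \<le> m" "m \<le> k"
  shows "lfixed (ev (\<cdot>) \<gamma> \<epsilon> (a_1k q r k) * S) m"
proof -
  interpret flip: bwm_rep "(\<cdot>)" q r "\<gamma> \<circ> (\<lambda>i. n - i)" "\<epsilon> \<circ> (\<lambda>i. n - i)" n by (rule flip_rep)
  have flip: "flip.lfixed v i \<longleftrightarrow> lfixed v (n - i)" for v i
    by (simp add: flip.lfixed_def lfixed_def)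
  have "flip.lfixed (ev (\<cdot>) (\<gamma> \<circ> (\<lambda>i. n - i)) (\<epsilon> \<circ> (\<lambda>i. n - i)) (a_k1 q r k) * S) (n - m)"
    by (rule flip.lfixed_a_S) (use assms in \<open>auto simp: flip[unfolded assms(1)]\<close>)
  then show ?thesis
    using assms reindex_a[of k q r] by (simp add: flip[unfolded assms(1)] flip: ev_reindex)
qed

end

section \<open>Closure of the free algebras\<close>

lemma free_alg_mono: "m \<le> n \<Longrightarrow> p \<in> carrier (free_alg m) \<Longrightarrow> p \<in> carrier (free_alg n)"
  unfolding free_alg_carrier by fastforce

lemma sum_closed:
  "(\<And>x. x \<in> A \<Longrightarrow> f x \<in> carrier (free_alg n)) \<Longrightarrow> sum f A \<in> carrier (free_alg n)"
  by (induction A rule: infinite_finite_induct) (auto intro: free_alg_closed)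

lemma gs_es_closed:
  assumes "set xs \<subseteq> {1..<n}"
  shows "gs xs \<in> carrier (free_alg n)" "es xs \<in> carrier (free_alg n)"
  using assms by (induction xs) (auto simp: gs_def es_def intro!: free_alg_closed)

lemma b_k1_closed: "b_k1 q r k \<in> carrier (free_alg (Suc k))"
  unfolding b_k1_def d_def by (intro free_alg_closed sum_closed gs_es_closed) auto

lemma a_k1_closed: "a_k1 q r k \<in> carrier (free_alg (Suc k))"
  unfolding a_k1_def dbar_def by (intro free_alg_closed sum_closed gs_es_closed) auto

lemma b_1k_closed: "b_1k q r k \<in> carrier (free_alg (Suc k))"
  unfolding reindex_b[symmetric] by (rule reindex_closed[OF b_k1_closed]) auto

lemma a_1k_closed: "a_1k q r k \<in> carrier (free_alg (Suc k))"
  unfolding reindex_a[symmetric] by (rule reindex_closed[OF a_k1_closed]) auto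

section \<open>The character and the recursive symmetrizers\<close>

lemma complex_algebra_complex: "complex_algebra ((*) :: complex \<Rightarrow> complex \<Rightarrow> complex)"
  by unfold_locales (simp_all add: algebra_simps)

lemmas ev_complex =
  complex_algebra.ev_generators[OF complex_algebra_complex]
  complex_algebra.ev_add[OF complex_algebra_complex]
  complex_algebra.ev_sum[OF complex_algebra_complex]
  complex_algebra.ev_mult[OF complex_algebra_complex]
  complex_algebra.ev_const[OF complex_algebra_complex]
  complex_algebra.ev_reindex[OF complex_algebra_complex]
  complex_algebra.ev_gs[OF complex_algebra_complex]
  complex_algebra.ev_es[OF complex_algebra_complex]

text \<open>The one-dimensional representation through which the algebra acts on an invariant element.\<close>

definition character :: "complex \<Rightarrow> ncpoly \<Rightarrow> complex" where
  "character q = ev (*) (\<lambda>_. q) (\<lambda>_. 0)"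

lemma character_simps [simp]:
  "character q 1 = 1" "character q (p * s) = character q p * character q s"
  "character q (const c) = c" "character q (reindex f p) = character q p"
  by (simp_all add: character_def ev_complex comp_def)

text \<open>Both recursions are kept as noncommutative polynomials, so that they can be evaluated in every
  algebra and with shifted indices. The first one is visibly right invariant, the second one left invariant; that they
  agree modulo the relations is \<open>sym_left_eq_right\<close>.\<close>

primrec sym_right :: "complex \<Rightarrow> complex \<Rightarrow> nat \<Rightarrow> ncpoly" where
  "sym_right q r 0 = 1"
| "sym_right q r (Suc k) = const (1 / (q ^ k * qint q (int (Suc k)))) * (sym_right q r k * b_k1 q r k)"

primrec sym_left :: "complex \<Rightarrow> complex \<Rightarrow> nat \<Rightarrow> ncpoly" where
  "sym_left q r 0 = 1"
| "sym_left q r (Suc k) = const (1 / (q ^ k * qint q (int (Suc k)))) * (a_k1 q r k * sym_left q r k)"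

lemma sym_closed:
  "sym_right q r k \<in> carrier (free_alg k)" "sym_left q r k \<in> carrier (free_alg k)"
  by (induction k)
    (auto intro!: free_alg_closed b_k1_closed a_k1_closed intro: free_alg_mono[of k "Suc k" for k])

context bwm_params
begin

lemma character_rep: "bwm_rep (*) q r (\<lambda>_. q) (\<lambda>_. 0) n"
  by (intro bwm_rep.intro complex_algebra_complex bwm_params_axioms bwm_rep_axioms.intro)
    (simp_all add: qhat_def field_simps)

lemma qint_sum: "q ^ k * qint q (int (Suc k)) = (\<Sum>i\<le>k. q ^ (2 * i))"
  and qint_nz: "q ^ k * qint q (int (Suc k)) \<noteq> 0"
proof -
  have 1: "q * q - 1 \<noteq> 0"
    using q_power[of 2] by (simp add: power2_eq_square)
  have 2: "(q * q - 1) * (\<Sum>i\<le>k. q ^ (2 * i)) = q ^ (2 * Suc k) - 1"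
    by (induction k) (simp_all add: algebra_simps)
  have 3: "(q * q - 1) * (q ^ k * qint q (int (Suc k))) = q ^ (2 * Suc k) - 1"
  proof -
    have "q - inverse q = (q * q - 1) / q" by (simp add: diff_divide_distrib inverse_eq_divide)
    moreover have "q powi int (Suc k) - q powi (- int (Suc k)) = (q ^ (2 * Suc k) - 1) / q ^ Suc k"
    proof -
      have "q ^ (2 * Suc k) = q ^ Suc k * q ^ Suc k" by (simp only: mult_2 power_add)
      then show ?thesis
        unfolding power_int_minus power_int_of_nat
        by (simp add: diff_divide_distrib inverse_eq_divide)
    qed
    ultimately show ?thesis
      using 1 by (simp add: qint_def del: of_nat_Suc)
  qed
  show "q ^ k * qint q (int (Suc k)) = (\<Sum>i\<le>k. q ^ (2 * i))"
    by (rule mult_left_cancel[OF 1, THEN iffD1]) (simp only: 2 3)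
  show "q ^ k * qint q (int (Suc k)) \<noteq> 0"
  proof
    assume "q ^ k * qint q (int (Suc k)) = 0"
    with 3 have "q ^ (2 * Suc k) = 1" by (metis mult_zero_right right_minus_eq)
    with q_power[of "2 * Suc k"] show False by simp
  qed
qed

text \<open>Each summand with a factor \<open>e\<close> is killed, and the rest is a geometric sum.\<close>

lemma character_b:
  "character q (b_k1 q r k) = q ^ k * qint q (int (Suc k))"
  "character q (a_k1 q r k) = q ^ k * qint q (int (Suc k))"
  "character q (b_1k q r k) = q ^ k * qint q (int (Suc k))"
  "character q (a_1k q r k) = q ^ k * qint q (int (Suc k))"
proof -
  have gs: "character q (gs xs) = q ^ length xs" for xs
    by (induction xs) (simp_all add: character_def ev_complex)
  have es: "character q (es xs) = 0" if "xs \<noteq> []" for xs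
    using that by (cases xs) (simp_all add: character_def ev_complex)
  have sum: "character q (sum f A) = (\<Sum>x\<in>A. character q (f x))"
    and add: "character q (p + s) = character q p + character q s" for f and A :: "nat set" and p s
    by (simp_all add: character_def ev_complex)
  have d: "character q (d q (Suc k) i) = 0" "character q (dbar q (Suc k) i) = 0" if "i \<in> {1..k}" for i
    using that by (simp_all add: d_def dbar_def es del: upt_Suc)
  have square: "q ^ (2 * i) = q ^ i * q ^ i" for i
    by (simp only: mult_2 power_add)
  show b: "character q (b_k1 q r k) = q ^ k * qint q (int (Suc k))"
    unfolding qint_sum by (simp add: b_k1_def add sum gs d atLeast0AtMost square del: upt_Suc cong: sum.cong_simp)
  show a: "character q (a_k1 q r k) = q ^ k * qint q (int (Suc k))"
    unfolding qint_sum by (simp add: a_k1_def add sum gs d atLeast0AtMost square del: upt_Suc cong: sum.cong_simp)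
  show "character q (b_1k q r k) = q ^ k * qint q (int (Suc k))"
    using b by (simp flip: reindex_b)
  show "character q (a_1k q r k) = q ^ k * qint q (int (Suc k))"
    using a by (simp flip: reindex_a)
qed

lemma character_sym [simp]:
  "character q (sym_right q r k) = 1" "character q (sym_left q r k) = 1"
  using qint_nz by (induction k) (simp_all add: character_b del: of_nat_Suc)

end

context bwm_rep
begin

lemma ev_ideal:
  assumes "p \<in> bwm_ideal q r n"
  shows "ev (\<cdot>) \<gamma> \<epsilon> p = 0"
proof -
  let ?J = "{p \<in> carrier (free_alg n). ev (\<cdot>) \<gamma> \<epsilon> p = 0}"
  interpret F: ring "free_alg n" by (rule ring_free_alg)
  have "ideal ?J (free_alg n)"
  proof (rule idealI[OF ring_free_alg])
    show "subgroup ?J (add_monoid (free_alg n))"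
    proof (rule F.add.subgroupI)
      fix p assume p: "p \<in> ?J"
      then have "\<ominus>\<^bsub>free_alg n\<^esub> p = - p"
        by (intro F.minus_equality) (auto intro: free_alg_closed)
      with p show "\<ominus>\<^bsub>free_alg n\<^esub> p \<in> ?J" by (auto intro: free_alg_closed)
    qed (auto intro: free_alg_closed exI[of _ 0])
  qed (auto intro: free_alg_closed)
  moreover have "bwm_relators q r n \<subseteq> ?J"
  proof
    fix x assume x: "x \<in> bwm_relators q r n"
    then have "ev (\<cdot>) \<gamma> \<epsilon> x = 0"
    proof (cases rule: bwm_relators_cases)
      case (2 i j)
      then show ?thesis using far_comm(1)[of i j] by (cases "Suc i < j") auto
    qed (use braid quad GE EG GGE GGE' in auto)
    with x relators_closed show "x \<in> ?J" by blast
  qed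
  ultimately have "bwm_ideal q r n \<subseteq> ?J"
    unfolding bwm_ideal_def by (intro F.genideal_minimal)
  with assms show ?thesis by blast
qed

lemma fixed_ev:
  assumes v: "\<And>i. \<lbrakk>1 \<le> i; i < k\<rbrakk> \<Longrightarrow> fixed v i" and k: "k \<le> n" and p: "p \<in> carrier (free_alg k)"
  shows "v * ev (\<cdot>) \<gamma> \<epsilon> p = character q p \<cdot> v"
proof -
  have "v * prod_list (map (case_bwm_gen \<gamma> \<epsilon>) xs)
      = prod_list (map (case_bwm_gen (\<lambda>_. q) (\<lambda>_. 0)) xs) \<cdot> v"
    if "\<And>x. x \<in> set xs \<Longrightarrow> gen_indices x \<subseteq> {1..<k}" for xs
    using that
  proof (induction xs)
    case (Cons x xs)
    have "v * case_bwm_gen \<gamma> \<epsilon> x = case_bwm_gen (\<lambda>_. q) (\<lambda>_. 0) x \<cdot> v"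
      using Cons.prems[of x] v k fixed_E[of _ v] by (cases x) (auto simp: fixed_def)
    then show ?case
      using Cons by (simp flip: mult.assoc)
  qed simp
  then show ?thesis
    using p unfolding free_alg_carrier
    by (simp add: ev_def character_def sum_distrib_left scale_sum_left cong: sum.cong)
qed

lemma lfixed_ev:
  assumes v: "\<And>i. \<lbrakk>1 \<le> i; i < k\<rbrakk> \<Longrightarrow> lfixed v i" and k: "k \<le> n" and p: "p \<in> carrier (free_alg k)"
  shows "ev (\<cdot>) \<gamma> \<epsilon> p * v = character q p \<cdot> v"
proof -
  have "prod_list (map (case_bwm_gen \<gamma> \<epsilon>) xs) * v
      = prod_list (map (case_bwm_gen (\<lambda>_. q) (\<lambda>_. 0)) xs) \<cdot> v"
    if "\<And>x. x \<in> set xs \<Longrightarrow> gen_indices x \<subseteq> {1..<k}" for xs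
    using that
  proof (induction xs)
    case (Cons x xs)
    have "case_bwm_gen \<gamma> \<epsilon> x * v = case_bwm_gen (\<lambda>_. q) (\<lambda>_. 0) x \<cdot> v"
      using Cons.prems[of x] v k lfixed_E[of _ v] by (cases x) (auto simp: lfixed_def)
    then show ?case
      using Cons by (simp add: mult.assoc mult.commute)
  qed simp
  then show ?thesis
    using p unfolding free_alg_carrier
    by (simp add: ev_def character_def sum_distrib_right scale_sum_left cong: sum.cong)
qed

lemma sym_right_fixed: "\<lbrakk>k \<le> n; 1 \<le> i; i < k\<rbrakk> \<Longrightarrow> fixed (ev (\<cdot>) \<gamma> \<epsilon> (sym_right q r k)) i"
proof (induction k arbitrary: i)
  case (Suc k)
  then show ?case
    using fixed_S_b[of k "ev (\<cdot>) \<gamma> \<epsilon> (sym_right q r k)" i] by (auto intro!: fixed_smul)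
qed simp

lemma lfixed_smul: "lfixed v i \<Longrightarrow> lfixed (c \<cdot> v) i"
  by (simp add: lfixed_def mult.commute)

lemma sym_left_lfixed: "\<lbrakk>k \<le> n; 1 \<le> i; i < k\<rbrakk> \<Longrightarrow> lfixed (ev (\<cdot>) \<gamma> \<epsilon> (sym_left q r k)) i"
proof (induction k arbitrary: i)
  case (Suc k)
  then show ?case
    using lfixed_a_S[of k "ev (\<cdot>) \<gamma> \<epsilon> (sym_left q r k)" i] by (auto intro!: lfixed_smul)
qed simp

text \<open>The product of a right invariant element with a left invariant one, both of character \<open>1\<close>,
  equals each of its factors.\<close>

lemma sym_left_eq_right:
  assumes "k \<le> n"
  shows "ev (\<cdot>) \<gamma> \<epsilon> (sym_left q r k) = ev (\<cdot>) \<gamma> \<epsilon> (sym_right q r k)"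
proof -
  have "ev (\<cdot>) \<gamma> \<epsilon> (sym_right q r k) * ev (\<cdot>) \<gamma> \<epsilon> (sym_left q r k) = 1 \<cdot> ev (\<cdot>) \<gamma> \<epsilon> (sym_right q r k)"
    using fixed_ev[OF sym_right_fixed[OF assms] assms sym_closed(2)] by simp
  moreover have "ev (\<cdot>) \<gamma> \<epsilon> (sym_right q r k) * ev (\<cdot>) \<gamma> \<epsilon> (sym_left q r k) = 1 \<cdot> ev (\<cdot>) \<gamma> \<epsilon> (sym_left q r k)"
    using lfixed_ev[OF sym_left_lfixed[OF assms] assms sym_closed(1)] by simp
  ultimately show ?thesis by simp
qed

lemma sym_right_lfixed:
  "\<lbrakk>k \<le> n; 1 \<le> i; i < k\<rbrakk> \<Longrightarrow> lfixed (ev (\<cdot>) \<gamma> \<epsilon> (sym_right q r k)) i"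
  using sym_left_lfixed[of k i] sym_left_eq_right[of k] by simp

lemma fixed_unique:
  assumes "p \<in> carrier (free_alg n)" "character q p = 1"
    and "(\<forall>i\<in>{1..<n}. fixed (ev (\<cdot>) \<gamma> \<epsilon> p) i) \<or> (\<forall>i\<in>{1..<n}. lfixed (ev (\<cdot>) \<gamma> \<epsilon> p) i)"
  shows "ev (\<cdot>) \<gamma> \<epsilon> p = ev (\<cdot>) \<gamma> \<epsilon> (sym_right q r n)"
  using assms(3)
proof
  assume "\<forall>i\<in>{1..<n}. fixed (ev (\<cdot>) \<gamma> \<epsilon> p) i"
  then have "ev (\<cdot>) \<gamma> \<epsilon> p * ev (\<cdot>) \<gamma> \<epsilon> (sym_right q r n) = 1 \<cdot> ev (\<cdot>) \<gamma> \<epsilon> p"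
    using fixed_ev[of n "ev (\<cdot>) \<gamma> \<epsilon> p"] sym_closed(1) by simp
  moreover have "ev (\<cdot>) \<gamma> \<epsilon> p * ev (\<cdot>) \<gamma> \<epsilon> (sym_right q r n) = 1 \<cdot> ev (\<cdot>) \<gamma> \<epsilon> (sym_right q r n)"
    using lfixed_ev[OF sym_right_lfixed] assms(1,2) by simp
  ultimately show ?thesis by simp
next
  assume "\<forall>i\<in>{1..<n}. lfixed (ev (\<cdot>) \<gamma> \<epsilon> p) i"
  then have "ev (\<cdot>) \<gamma> \<epsilon> (sym_right q r n) * ev (\<cdot>) \<gamma> \<epsilon> p = 1 \<cdot> ev (\<cdot>) \<gamma> \<epsilon> p"
    using lfixed_ev[of n "ev (\<cdot>) \<gamma> \<epsilon> p"] sym_closed(1) by simp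
  moreover have "ev (\<cdot>) \<gamma> \<epsilon> (sym_right q r n) * ev (\<cdot>) \<gamma> \<epsilon> p = 1 \<cdot> ev (\<cdot>) \<gamma> \<epsilon> (sym_right q r n)"
    using fixed_ev[OF sym_right_fixed] assms(1,2) by simp
  ultimately show ?thesis by simp
qed

text \<open>The first recursion is the definition of \<open>sym_right\<close> and the third that of \<open>sym_left\<close>. In the other two the
  left-hand side is invariant on one side by the flipped theorems, and has character \<open>1\<close>.\<close>

theorem sym_recursions:
  assumes n: "n = Suc k"
  defines "c \<equiv> 1 / (q ^ k * qint q (int n))" and "s \<equiv> sym_right q r k"
  shows "ev (\<cdot>) \<gamma> \<epsilon> (const c * (s * b_k1 q r k)) = ev (\<cdot>) \<gamma> \<epsilon> (sym_right q r n)"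
    and "ev (\<cdot>) \<gamma> \<epsilon> (const c * (reindex Suc s * b_1k q r k)) = ev (\<cdot>) \<gamma> \<epsilon> (sym_right q r n)"
    and "ev (\<cdot>) \<gamma> \<epsilon> (const c * (a_k1 q r k * s)) = ev (\<cdot>) \<gamma> \<epsilon> (sym_right q r n)"
    and "ev (\<cdot>) \<gamma> \<epsilon> (const c * (a_1k q r k * reindex Suc s)) = ev (\<cdot>) \<gamma> \<epsilon> (sym_right q r n)"
proof -
  interpret shift: bwm_rep "(\<cdot>)" q r "\<gamma> \<circ> Suc" "\<epsilon> \<circ> Suc" "n - 1" by (rule shift_rep)
  have shifted: "fixed (ev (\<cdot>) \<gamma> \<epsilon> (reindex Suc s)) i" "lfixed (ev (\<cdot>) \<gamma> \<epsilon> (reindex Suc s)) i"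
    if "1 < i" "i \<le> k" for i
    using shift.sym_right_fixed[of k "i - 1"] shift.sym_right_lfixed[of k "i - 1"] that n
    by (simp_all add: s_def ev_reindex fixed_def lfixed_def shift.fixed_def shift.lfixed_def)
  have closed: "s \<in> carrier (free_alg n)" "reindex Suc s \<in> carrier (free_alg n)"
    unfolding s_def n
    by (rule free_alg_mono[OF _ sym_closed(1)], simp, rule reindex_closed[OF sym_closed(1)], auto)
  have c: "c * (q ^ k * qint q (int (Suc k))) = 1"
    using qint_nz[of k] by (simp add: c_def n)
  have s: "character q s = 1" by (simp add: s_def)
  show "ev (\<cdot>) \<gamma> \<epsilon> (const c * (s * b_k1 q r k)) = ev (\<cdot>) \<gamma> \<epsilon> (sym_right q r n)"
    by (simp add: c_def s_def n)
  show "ev (\<cdot>) \<gamma> \<epsilon> (const c * (reindex Suc s * b_1k q r k)) = ev (\<cdot>) \<gamma> \<epsilon> (sym_right q r n)"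
  proof (rule fixed_unique)
    show "const c * (reindex Suc s * b_1k q r k) \<in> carrier (free_alg n)"
      using closed b_1k_closed by (auto simp: n intro!: free_alg_closed)
    have "fixed (ev (\<cdot>) \<gamma> \<epsilon> (reindex Suc s) * ev (\<cdot>) \<gamma> \<epsilon> (b_1k q r k)) i" if "1 \<le> i" "i \<le> k" for i
      using fixed_S_b'[OF n shifted(1)] that by simp
    then show "(\<forall>i\<in>{1..<n}. fixed (ev (\<cdot>) \<gamma> \<epsilon> (const c * (reindex Suc s * b_1k q r k))) i)
        \<or> (\<forall>i\<in>{1..<n}. lfixed (ev (\<cdot>) \<gamma> \<epsilon> (const c * (reindex Suc s * b_1k q r k))) i)"
      by (auto simp: n intro!: fixed_smul)
  qed (use c s in \<open>simp add: character_b\<close>)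
  show "ev (\<cdot>) \<gamma> \<epsilon> (const c * (a_k1 q r k * s)) = ev (\<cdot>) \<gamma> \<epsilon> (sym_right q r n)"
    using sym_left_eq_right[of n] sym_left_eq_right[of k] by (simp add: c_def s_def n)
  show "ev (\<cdot>) \<gamma> \<epsilon> (const c * (a_1k q r k * reindex Suc s)) = ev (\<cdot>) \<gamma> \<epsilon> (sym_right q r n)"
  proof (rule fixed_unique)
    show "const c * (a_1k q r k * reindex Suc s) \<in> carrier (free_alg n)"
      using closed a_1k_closed by (auto simp: n intro!: free_alg_closed)
    have "lfixed (ev (\<cdot>) \<gamma> \<epsilon> (a_1k q r k) * ev (\<cdot>) \<gamma> \<epsilon> (reindex Suc s)) i" if "1 \<le> i" "i \<le> k" for i
      using lfixed_a_S'[OF n shifted(2)] that by simp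
    then show "(\<forall>i\<in>{1..<n}. fixed (ev (\<cdot>) \<gamma> \<epsilon> (const c * (a_1k q r k * reindex Suc s))) i)
        \<or> (\<forall>i\<in>{1..<n}. lfixed (ev (\<cdot>) \<gamma> \<epsilon> (const c * (a_1k q r k * reindex Suc s))) i)"
      by (auto simp: n intro!: lfixed_smul)
  qed (use c s in \<open>simp add: character_b\<close>)
qed

end

section \<open>The product of all BWM algebras\<close>

lemma const_arith:
  "const (a + b) = const a + const b" "const (a * b) = const a * const b" "const 1 = 1" "const 0 = 0"
  by (simp_all add: const_def single_add mult_single)

lemma const_central: "p * const c = const c * p"
proof -
  have "Poly_Mapping.single w b * const c = const c * Poly_Mapping.single w b" for w b
    by (simp add: const_def mult_single mult.commute)
  then have "(\<Sum>w\<in>Poly_Mapping.keys p. Poly_Mapping.single w (Poly_Mapping.lookup p w)) * const c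
      = const c * (\<Sum>w\<in>Poly_Mapping.keys p. Poly_Mapping.single w (Poly_Mapping.lookup p w))"
    by (simp add: sum_distrib_left sum_distrib_right)
  then show ?thesis by (simp only: flip: ncpoly_expand)
qed

lemma free_alg_minus:
  assumes "p \<in> carrier (free_alg n)" "s \<in> carrier (free_alg n)"
  shows "p \<ominus>\<^bsub>free_alg n\<^esub> s = p - s"
proof -
  interpret F: ring "free_alg n" by (rule ring_free_alg)
  have "\<ominus>\<^bsub>free_alg n\<^esub> s = - s"
    using assms by (intro F.minus_equality) (auto intro: free_alg_closed)
  then show ?thesis by (simp add: a_minus_def)
qed

lemma carrier_BWM: "carrier (BWM q r n) = cls q r n ` carrier (free_alg n)"
  by (auto simp: BWM_def FactRing_def A_RCOSETS_def' cls_def)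

lemma cls_closed: "p \<in> carrier (free_alg n) \<Longrightarrow> cls q r n p \<in> carrier (BWM q r n)"
  by (simp add: carrier_BWM)

lemma cls_mult:
  "\<lbrakk>p \<in> carrier (free_alg n); s \<in> carrier (free_alg n)\<rbrakk>
    \<Longrightarrow> cls q r n p \<otimes>\<^bsub>BWM q r n\<^esub> cls q r n s = cls q r n (p * s)"
  using ring_hom_mult[OF cls_ring_hom[of q r n], of p s] by simp

lemma cls_add:
  "\<lbrakk>p \<in> carrier (free_alg n); s \<in> carrier (free_alg n)\<rbrakk>
    \<Longrightarrow> cls q r n p \<oplus>\<^bsub>BWM q r n\<^esub> cls q r n s = cls q r n (p + s)"
  using ring_hom_add[OF cls_ring_hom[of q r n], of p s] by simp

lemma cls_one: "\<one>\<^bsub>BWM q r n\<^esub> = cls q r n 1"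
  using ring_hom_one[OF cls_ring_hom[of q r n]] by simp

lemma cls_zero: "\<zero>\<^bsub>BWM q r n\<^esub> = cls q r n 0"
  using ring_hom_zero[OF cls_ring_hom[of q r n] ring_free_alg ring_BWM] by simp

lemma cls_scale:
  "p \<in> carrier (free_alg n) \<Longrightarrow> scale q r n c (cls q r n p) = cls q r n (const c * p)"
  by (simp add: scale_def cls_mult free_alg_closed)

lemma cls_eq_iff:
  assumes "p \<in> carrier (free_alg n)" "s \<in> carrier (free_alg n)"
  shows "cls q r n p = cls q r n s \<longleftrightarrow> p - s \<in> bwm_ideal q r n"
  using ring.quotient_eq_iff_same_a_r_cos[OF ring_free_alg ideal_bwm assms, of q r]
  by (simp add: free_alg_minus assms cls_def)

text \<open>A type cannot depend on \<open>q\<close>, \<open>r\<close> and \<open>n\<close>, but the product over all values of these parameters is a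
  single ring type.\<close>

type_synonym bwm_index = "complex \<times> complex \<times> nat"

abbreviation free_at :: "bwm_index \<Rightarrow> ncpoly ring" where
  "free_at a \<equiv> free_alg (snd (snd a))"

abbreviation bwm_at :: "bwm_index \<Rightarrow> ncpoly set ring" where
  "bwm_at a \<equiv> BWM (fst a) (fst (snd a)) (snd (snd a))"

abbreviation cls_at :: "bwm_index \<Rightarrow> ncpoly \<Rightarrow> ncpoly set" where
  "cls_at a \<equiv> cls (fst a) (fst (snd a)) (snd (snd a))"

typedef bwm_product = "{x :: bwm_index \<Rightarrow> ncpoly set. \<forall>a. x a \<in> carrier (bwm_at a)}"
  morphisms component Family
proof
  show "(\<lambda>a. \<zero>\<^bsub>bwm_at a\<^esub>) \<in> {x. \<forall>a. x a \<in> carrier (bwm_at a)}"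
    by (simp add: cls_zero cls_closed free_alg_closed)
qed

lemma component_closed [simp]: "component x a \<in> carrier (bwm_at a)"
  using component by blast

lemma component_Family: "(\<And>a. x a \<in> carrier (bwm_at a)) \<Longrightarrow> component (Family x) = x"
  by (rule Family_inverse) blast

lemma product_eqI: "(\<And>a. component x a = component y a) \<Longrightarrow> x = y"
  by (metis component_inject ext)

instantiation bwm_product :: "{ring,monoid_mult}"
begin

definition "0 = Family (\<lambda>a. \<zero>\<^bsub>bwm_at a\<^esub>)"
definition "1 = Family (\<lambda>a. \<one>\<^bsub>bwm_at a\<^esub>)"
definition "x + y = Family (\<lambda>a. component x a \<oplus>\<^bsub>bwm_at a\<^esub> component y a)"
definition "x - y = Family (\<lambda>a. component x a \<ominus>\<^bsub>bwm_at a\<^esub> component y a)"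
definition "- x = Family (\<lambda>a. \<ominus>\<^bsub>bwm_at a\<^esub> component x a)"
definition "x * y = Family (\<lambda>a. component x a \<otimes>\<^bsub>bwm_at a\<^esub> component y a)"

lemma component_simps [simp]:
  "component 0 a = \<zero>\<^bsub>bwm_at a\<^esub>"
  "component 1 a = \<one>\<^bsub>bwm_at a\<^esub>"
  "component (x + y) a = component x a \<oplus>\<^bsub>bwm_at a\<^esub> component y a"
  "component (x - y) a = component x a \<ominus>\<^bsub>bwm_at a\<^esub> component y a"
  "component (- x) a = \<ominus>\<^bsub>bwm_at a\<^esub> component x a"
  "component (x * y) a = component x a \<otimes>\<^bsub>bwm_at a\<^esub> component y a"
proof -
  interpret R: ring "bwm_at a" for a by (rule ring_BWM)
  show "component 0 a = \<zero>\<^bsub>bwm_at a\<^esub>"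
    "component 1 a = \<one>\<^bsub>bwm_at a\<^esub>"
    "component (x + y) a = component x a \<oplus>\<^bsub>bwm_at a\<^esub> component y a"
    "component (x - y) a = component x a \<ominus>\<^bsub>bwm_at a\<^esub> component y a"
    "component (- x) a = \<ominus>\<^bsub>bwm_at a\<^esub> component x a"
    "component (x * y) a = component x a \<otimes>\<^bsub>bwm_at a\<^esub> component y a"
    by (simp_all add: zero_bwm_product_def one_bwm_product_def plus_bwm_product_def
        minus_bwm_product_def uminus_bwm_product_def times_bwm_product_def component_Family)
qed

instance
proof
  interpret R: ring "bwm_at a" for a by (rule ring_BWM)
  fix x y z :: bwm_product
  show "x + y + z = x + (y + z)" "x + y = y + x" "0 + x = x" "- x + x = 0" "x - y = x + - y"
    "x * y * z = x * (y * z)" "1 * x = x" "x * 1 = x"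
    "(x + y) * z = x * z + y * z" "x * (y + z) = x * y + x * z"
    by (rule product_eqI; simp add: R.a_assoc R.m_assoc R.l_distr R.r_distr R.r_neg R.minus_eq R.a_comm R.a_lcomm)+
qed

end

text \<open>Elements of the product given by a choice of representatives.\<close>

definition family_of :: "(bwm_index \<Rightarrow> ncpoly) \<Rightarrow> bwm_product" where
  "family_of F = Family (\<lambda>a. cls_at a (F a))"

definition product_smul :: "complex \<Rightarrow> bwm_product \<Rightarrow> bwm_product" where
  "product_smul c x = family_of (\<lambda>a. const c) * x"

lemma component_family_of:
  "(\<And>a. F a \<in> carrier (free_at a)) \<Longrightarrow> component (family_of F) a = cls_at a (F a)"
  by (simp add: family_of_def component_Family cls_closed)

lemma family_of_cases:
  obtains F where "\<And>a. F a \<in> carrier (free_at a)" "x = family_of F"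
proof -
  have "\<forall>a. \<exists>p. p \<in> carrier (free_at a) \<and> component x a = cls_at a p"
    using component_closed[of x] unfolding carrier_BWM by blast
  then obtain F where F: "F a \<in> carrier (free_at a)" "component x a = cls_at a (F a)" for a
    by metis
  then have "x = family_of F" by (intro product_eqI) (simp add: component_family_of)
  with F(1) that show ?thesis by blast
qed

lemma family_of_arith:
  assumes "\<And>a. F a \<in> carrier (free_at a)" "\<And>a. H a \<in> carrier (free_at a)"
  shows "family_of F + family_of H = family_of (\<lambda>a. F a + H a)"
    and "family_of F * family_of H = family_of (\<lambda>a. F a * H a)"
    and "family_of F - family_of H = family_of (\<lambda>a. F a - H a)"
proof -
  have add: "family_of F + family_of H = family_of (\<lambda>a. F a + H a)"
    if "\<And>a. F a \<in> carrier (free_at a)" "\<And>a. H a \<in> carrier (free_at a)" for F H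
    using that by (intro product_eqI) (simp add: component_family_of free_alg_closed cls_add)
  show "family_of F + family_of H = family_of (\<lambda>a. F a + H a)"
    by (rule add) (simp_all add: assms)
  show "family_of F * family_of H = family_of (\<lambda>a. F a * H a)"
    using assms by (intro product_eqI) (simp add: component_family_of free_alg_closed cls_mult)
  show "family_of F - family_of H = family_of (\<lambda>a. F a - H a)"
    using add[of "\<lambda>a. F a - H a" H] assms by (simp add: free_alg_closed diff_eq_eq)
qed

lemma family_of_smul:
  assumes "\<And>a. F a \<in> carrier (free_at a)"
  shows "product_smul c (family_of F) = family_of (\<lambda>a. const c * F a)"
  unfolding product_smul_def by (rule family_of_arith) (simp_all add: assms free_alg_closed)

lemma family_of_one: "1 = family_of (\<lambda>a. 1)"
  by (intro product_eqI) (simp add: component_family_of free_alg_closed cls_one)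

lemma complex_algebra_product: "complex_algebra product_smul"
proof unfold_locales
  fix b c :: complex and x y :: bwm_product
  show "product_smul c (x + y) = product_smul c x + product_smul c y"
    by (simp add: product_smul_def distrib_left)
  show "product_smul (b + c) x = product_smul b x + product_smul c x"
    by (simp add: product_smul_def const_arith free_alg_closed distrib_right flip: family_of_arith)
  show "product_smul b (product_smul c x) = product_smul (b * c) x"
    by (simp add: product_smul_def const_arith free_alg_closed mult.assoc flip: family_of_arith)
  show "product_smul 1 x = x"
    by (simp add: product_smul_def const_arith flip: family_of_one)
  show "product_smul c x * y = product_smul c (x * y)"
    by (simp add: product_smul_def mult.assoc)
  obtain F where F: "\<And>a. F a \<in> carrier (free_at a)" "x = family_of F"
    using family_of_cases[of x] by blast
  have "x * family_of (\<lambda>a. const c) = family_of (\<lambda>a. const c) * x"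
    using F by (simp add: family_of_arith free_alg_closed const_central)
  then show "x * product_smul c y = product_smul c (x * y)"
    by (simp add: product_smul_def flip: mult.assoc)
qed

context bwm_params
begin

text \<open>The generators of the factor with index \<open>(q, r, n)\<close>, continued to the other factors by the character, so that the
  relations for \<open>q\<close>, \<open>r\<close>, \<open>n\<close> hold in every factor whatever its own parameters are.\<close>

definition gpoly :: "nat \<Rightarrow> nat \<Rightarrow> bwm_index \<Rightarrow> ncpoly" where
  "gpoly n i a = (if a = (q, r, n) \<and> 1 \<le> i \<and> i < n then g i else const q)"

definition epoly :: "nat \<Rightarrow> nat \<Rightarrow> bwm_index \<Rightarrow> ncpoly" where
  "epoly n i a = (if a = (q, r, n) \<and> 1 \<le> i \<and> i < n then e i else 0)"

abbreviation product_ev :: "nat \<Rightarrow> ncpoly \<Rightarrow> bwm_product" where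
  "product_ev n \<equiv> ev product_smul (\<lambda>i. family_of (gpoly n i)) (\<lambda>i. family_of (epoly n i))"

lemma gpoly_closed: "gpoly n i a \<in> carrier (free_at a)" "epoly n i a \<in> carrier (free_at a)"
  by (auto simp: gpoly_def epoly_def intro!: free_alg_closed)

text \<open>Outside the factor \<open>(q, r, n)\<close> the relations hold already for the representatives, which are scalars there.\<close>

lemma family_of_eqI:
  assumes "\<And>a. F a \<in> carrier (free_at a)" "\<And>a. H a \<in> carrier (free_at a)"
    and "F (q, r, n) - H (q, r, n) \<in> bwm_relators q r n"
    and "\<And>a. a \<noteq> (q, r, n) \<Longrightarrow> F a = H a"
  shows "family_of F = family_of H"
proof -
  have "bwm_relators q r n \<subseteq> bwm_ideal q r n"
    unfolding bwm_ideal_def by (rule ring.genideal_self[OF ring_free_alg relators_closed])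
  with assms(3) have "F (q, r, n) - H (q, r, n) \<in> bwm_ideal q r n" by blast
  then have "cls q r n (F (q, r, n)) = cls q r n (H (q, r, n))"
    using assms(1,2)[of "(q, r, n)"] by (simp add: cls_eq_iff)
  then have "cls_at a (F a) = cls_at a (H a)" for a
    using assms(4)[of a] by (cases "a = (q, r, n)") simp_all
  then show ?thesis by (simp add: family_of_def)
qed

lemma product_rep:
  "bwm_rep product_smul q r (\<lambda>i. family_of (gpoly n i)) (\<lambda>i. family_of (epoly n i)) n"
proof -
  note arith = family_of_arith family_of_smul family_of_one gpoly_closed free_alg_closed
  note polys = gpoly_def epoly_def
  have qq: "const q * const q = 1 + const (qhat q) * const q"
  proof -
    have "q * q = 1 + qhat q * q" by (simp add: q_qhat[symmetric] mult.commute)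
    then have "const (q * q) = const (1 + qhat q * q)" by (rule arg_cong)
    then show ?thesis by (simp only: const_arith)
  qed
  show ?thesis
  proof (intro bwm_rep.intro complex_algebra_product bwm_params_axioms bwm_rep_axioms.intro)
    fix i :: nat assume "1 \<le> i" "Suc i < n"
    then show "family_of (gpoly n i) * family_of (gpoly n (Suc i)) * family_of (gpoly n i)
        = family_of (gpoly n (Suc i)) * family_of (gpoly n i) * family_of (gpoly n (Suc i))"
      using bwm_relators_intros(1)[of i n q r]
      by (simp add: arith) (rule family_of_eqI[where n = n]; (simp add: arith)?; simp add: polys)
  next
    fix i j :: nat assume "1 \<le> i" "Suc i < j" "j < n"
    then show "family_of (gpoly n i) * family_of (gpoly n j) = family_of (gpoly n j) * family_of (gpoly n i)"
      using bwm_relators_intros(2)[of i n j q r]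
      by (simp add: arith) (rule family_of_eqI[where n = n]; (simp add: arith)?; simp add: polys)
  next
    fix i :: nat assume "1 \<le> i" "i < n"
    then show "family_of (gpoly n i) * family_of (gpoly n i) = 1 + product_smul (qhat q) (family_of (gpoly n i))
        - product_smul (inverse r * qhat q) (family_of (epoly n i))"
      using bwm_relators_intros(3)[of i n q r] qq
      by (simp add: arith) (rule family_of_eqI[where n = n]; (simp add: arith)?; simp add: polys)
  next
    fix i :: nat assume "1 \<le> i" "i < n"
    then show "family_of (gpoly n i) * family_of (epoly n i) = product_smul (inverse r) (family_of (epoly n i))"
      using bwm_relators_intros(4)[of i n r q]
      by (simp add: arith) (rule family_of_eqI[where n = n]; (simp add: arith)?; simp add: polys)
  next
    fix i :: nat assume "1 \<le> i" "i < n"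
    then show "family_of (epoly n i) * family_of (gpoly n i) = product_smul (inverse r) (family_of (epoly n i))"
      using bwm_relators_intros(5)[of i n r q]
      by (simp add: arith) (rule family_of_eqI[where n = n]; (simp add: arith)?; simp add: polys)
  next
    fix i :: nat assume "1 \<le> i" "Suc i < n"
    then show "family_of (gpoly n i) * family_of (gpoly n (Suc i)) * family_of (epoly n i) = family_of (epoly n (Suc i)) * family_of (epoly n i)"
      using bwm_relators_intros(6)[of i n q r]
      by (simp add: arith) (rule family_of_eqI[where n = n]; (simp add: arith)?; simp add: polys)
  next
    fix i :: nat assume "1 \<le> i" "Suc i < n"
    then show "family_of (gpoly n (Suc i)) * family_of (gpoly n i) * family_of (epoly n (Suc i)) = family_of (epoly n i) * family_of (epoly n (Suc i))"
      using bwm_relators_intros(7)[of i n q r]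
      by (simp add: arith) (rule family_of_eqI[where n = n]; (simp add: arith)?; simp add: polys)
  qed
qed

lemma component_ev:
  assumes p: "p \<in> carrier (free_alg n)"
  shows "component (product_ev n p) (q, r, n) = cls q r n p"
proof -
  interpret P: complex_algebra product_smul by (rule complex_algebra_product)
  have smul: "component (product_smul c x) (q, r, n) = scale q r n c (component x (q, r, n))" for c x
    by (simp add: product_smul_def component_family_of free_alg_closed scale_def)
  have word: "Poly_Mapping.single (Word xs) 1 \<in> carrier (free_alg n) \<and>
      component (prod_list (map (case_bwm_gen (\<lambda>i. family_of (gpoly n i)) (\<lambda>i. family_of (epoly n i))) xs)) (q, r, n)
        = cls q r n (Poly_Mapping.single (Word xs) 1)"
    if "\<And>x. x \<in> set xs \<Longrightarrow> gen_indices x \<subseteq> {1..<n}" for xs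
    using that
  proof (induction xs)
    case Nil
    then show ?case
      using single_one[where ?'a = bwm_word and ?'b = complex]
      by (simp add: cls_one zero_bwm_word_def free_alg_closed)
  next
    case (Cons x xs)
    have split: "Poly_Mapping.single (Word (x # xs)) (1::complex)
        = Poly_Mapping.single (Word [x]) 1 * Poly_Mapping.single (Word xs) 1"
      by (simp add: mult_single plus_bwm_word_def)
    have x: "Poly_Mapping.single (Word [x]) 1 \<in> carrier (free_alg n)"
      using Cons.prems[of x] by (auto simp: free_alg_carrier)
    have "component (case_bwm_gen (\<lambda>i. family_of (gpoly n i)) (\<lambda>i. family_of (epoly n i)) x) (q, r, n)
        = cls q r n (Poly_Mapping.single (Word [x]) 1)"
      using Cons.prems[of x]
      by (cases x) (auto simp: component_family_of gpoly_closed, auto simp: gpoly_def epoly_def g_def e_def)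
    with Cons x show ?case
      by (simp add: split cls_mult free_alg_closed del: mult_single)
  qed
  have "(\<Sum>w\<in>A. Poly_Mapping.single w (Poly_Mapping.lookup p w)) \<in> carrier (free_alg n) \<and>
      component (product_ev n (\<Sum>w\<in>A. Poly_Mapping.single w (Poly_Mapping.lookup p w))) (q, r, n)
      = cls q r n (\<Sum>w\<in>A. Poly_Mapping.single w (Poly_Mapping.lookup p w))"
    if "finite A" "A \<subseteq> Poly_Mapping.keys p" for A
    using that
  proof (induction A rule: finite_induct)
    case empty
    then show ?case by (simp add: cls_zero free_alg_closed)
  next
    case (insert w A)
    have "\<And>x. x \<in> set (letters w) \<Longrightarrow> gen_indices x \<subseteq> {1..<n}"
      using p insert.prems unfolding free_alg_carrier by blast
    note w = word[of "letters w", OF this]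
    have "Poly_Mapping.single w (Poly_Mapping.lookup p w)
        = const (Poly_Mapping.lookup p w) * Poly_Mapping.single (Word (letters w)) 1"
      by (simp add: const_def mult_single)
    moreover have "component (product_ev n (Poly_Mapping.single w (Poly_Mapping.lookup p w))) (q, r, n)
        = cls q r n (const (Poly_Mapping.lookup p w) * Poly_Mapping.single (Word (letters w)) 1)"
      using w by (simp add: smul cls_scale)
    ultimately show ?case
      using insert w by (simp add: cls_add free_alg_closed)
  qed
  from this[of "Poly_Mapping.keys p"] show ?thesis
    by (simp flip: ncpoly_expand)
qed

text \<open>The factor \<open>(q, r, n)\<close> is embedded in the product: passing to the component recovers the class, and conversely an
  evaluation at generators satisfying the relations annihilates the ideal.\<close>

lemma cls_eq_iff_ev:
  assumes "p \<in> carrier (free_alg n)" "s \<in> carrier (free_alg n)"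
  shows "cls q r n p = cls q r n s \<longleftrightarrow> product_ev n p = product_ev n s"
proof
  interpret P: bwm_rep product_smul q r "\<lambda>i. family_of (gpoly n i)" "\<lambda>i. family_of (epoly n i)" n
    by (rule product_rep)
  assume "cls q r n p = cls q r n s"
  then have "product_ev n (p - s) = 0"
    using assms by (intro P.ev_ideal) (simp add: cls_eq_iff)
  then show "product_ev n p = product_ev n s" by simp
next
  assume "product_ev n p = product_ev n s"
  then show "cls q r n p = cls q r n s"
    using component_ev[of p n] component_ev[of s n] assms by simp
qed

section \<open>The symmetrizer\<close>

text \<open>A right invariant \<open>p\<close> satisfies \<open>p\<^sup>2 = c p\<close>, where \<open>c\<close> is the value of the character on \<open>p\<close>; so for a nonzero
  invariant element idempotency says \<open>c = 1\<close>, which determines the element.\<close>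

lemma is_symmetrizer_cls:
  assumes p: "p \<in> carrier (free_alg n)"
  shows "is_symmetrizer q r n (cls q r n p) \<longleftrightarrow> cls q r n p = cls q r n (sym_right q r n)"
proof -
  interpret P: bwm_rep product_smul q r "\<lambda>i. family_of (gpoly n i)" "\<lambda>i. family_of (epoly n i)" n
    by (rule product_rep)
  interpret C: bwm_rep "(*)" q r "\<lambda>_. q" "\<lambda>_. 0" n
    by (rule character_rep)
  have fixed: "cls q r n p \<otimes>\<^bsub>BWM q r n\<^esub> cls q r n (g i) = scale q r n q (cls q r n p)
      \<longleftrightarrow> P.fixed (product_ev n p) i" if "i \<in> {1..<n}" "p \<in> carrier (free_alg n)" for i p
    using that by (simp add: cls_mult cls_scale cls_eq_iff_ev free_alg_closed P.fixed_def)
  have sq: "cls q r n p \<otimes>\<^bsub>BWM q r n\<^esub> cls q r n p = cls q r n (const (character q p) * p)"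
    if "\<forall>i\<in>{1..<n}. P.fixed (product_ev n p) i" "p \<in> carrier (free_alg n)" for p
    using that P.fixed_ev[of n "product_ev n p" p] by (simp add: cls_mult cls_eq_iff_ev free_alg_closed)
  have nz: "cls q r n p \<noteq> cls q r n 0" if "character q p = 1" "p \<in> carrier (free_alg n)" for p
    using that C.ev_ideal[of p] by (auto simp: cls_eq_iff free_alg_closed character_def)
  show ?thesis
  proof
    assume S: "is_symmetrizer q r n (cls q r n p)"
    then have p_fixed: "\<forall>i\<in>{1..<n}. P.fixed (product_ev n p) i"
      using fixed p by (simp add: is_symmetrizer_def)
    have "product_smul (character q p) (product_ev n p) = product_smul 1 (product_ev n p)"
      using S sq[OF p_fixed p] p by (simp add: is_symmetrizer_def cls_eq_iff_ev free_alg_closed)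
    moreover have "product_ev n p \<noteq> 0"
      using S cls_eq_iff_ev[OF p, of 0] by (simp add: is_symmetrizer_def cls_zero free_alg_closed)
    ultimately have "character q p = 1" by (simp only: P.scale_cancel_right) simp
    then show "cls q r n p = cls q r n (sym_right q r n)"
      using P.fixed_unique[OF p] p_fixed p by (simp add: cls_eq_iff_ev sym_closed)
  next
    assume "cls q r n p = cls q r n (sym_right q r n)"
    then show "is_symmetrizer q r n (cls q r n p)"
      using fixed[of _ "sym_right q r n"] sq[of "sym_right q r n"] nz[of "sym_right q r n"]
        P.sym_right_fixed[of n] sym_closed(1)[of q r n]
      by (simp add: is_symmetrizer_def cls_closed cls_zero const_arith)
  qed
qed

theorem symmetrizer_eq: "symmetrizer q r n = cls q r n (sym_right q r n)"
  unfolding symmetrizer_def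
proof (rule the_equality)
  show "is_symmetrizer q r n (cls q r n (sym_right q r n))"
    by (simp add: is_symmetrizer_cls sym_closed)
  fix S assume S: "is_symmetrizer q r n S"
  then obtain p where "p \<in> carrier (free_alg n)" "S = cls q r n p"
    by (auto simp: is_symmetrizer_def carrier_BWM)
  with S show "S = cls q r n (sym_right q r n)"
    by (simp add: is_symmetrizer_cls)
qed

end

theorem mainTheorem2:
  fixes q r :: complex and n :: nat
  assumes "q \<noteq> 0" and "r \<noteq> 0"
    and "\<And>k::nat. k > 0 \<Longrightarrow> q ^ k \<noteq> 1"
    and "\<And>k::int. r \<noteq> q powi k \<and> r \<noteq> - (q powi k)"
    and "n \<ge> 3"
  shows "(symmetrizer q r n =
           scale q r n (1 / (q ^ (n-1) * qint q (int n)))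
             (bwm_embed q r (n-1) n (symmetrizer q r (n-1)) \<otimes>\<^bsub>BWM q r n\<^esub> cls q r n (b_k1 q r (n-1))))
       \<and> (symmetrizer q r n =
           scale q r n (1 / (q ^ (n-1) * qint q (int n)))
             (bwm_shift q r (n-1) n (symmetrizer q r (n-1)) \<otimes>\<^bsub>BWM q r n\<^esub> cls q r n (b_1k q r (n-1))))
       \<and> (symmetrizer q r n =
           scale q r n (1 / (q ^ (n-1) * qint q (int n)))
             (cls q r n (a_k1 q r (n-1)) \<otimes>\<^bsub>BWM q r n\<^esub> bwm_embed q r (n-1) n (symmetrizer q r (n-1))))
       \<and> (symmetrizer q r n =
           scale q r n (1 / (q ^ (n-1) * qint q (int n)))
             (cls q r n (a_1k q r (n-1)) \<otimes>\<^bsub>BWM q r n\<^esub> bwm_shift q r (n-1) n (symmetrizer q r (n-1))))"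
proof -
  interpret bwm_params q r by unfold_locales (use assms in auto)
  interpret P: bwm_rep product_smul q r "\<lambda>i. family_of (gpoly n i)" "\<lambda>i. family_of (epoly n i)" n
    by (rule product_rep)
  obtain k where n: "n = Suc k" using assms(5) by (cases n) auto
  then have k: "n - 1 = k" by simp
  let ?s = "sym_right q r k"
  have s: "?s \<in> carrier (free_alg k)" by (rule sym_closed)
  have embed: "bwm_embed q r k n (symmetrizer q r k) = cls q r n (reindex id ?s)"
    unfolding bwm_embed_def symmetrizer_eq by (rule bwm_map_cls[OF _ s]) (simp add: n)
  have shift: "bwm_shift q r k n (symmetrizer q r k) = cls q r n (reindex Suc ?s)"
    unfolding bwm_shift_def symmetrizer_eq by (rule bwm_map_cls[OF _ s]) (simp add: n)
  have closed: "reindex id ?s \<in> carrier (free_alg n)" "reindex Suc ?s \<in> carrier (free_alg n)"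
    "b_k1 q r k \<in> carrier (free_alg n)" "b_1k q r k \<in> carrier (free_alg n)"
    "a_k1 q r k \<in> carrier (free_alg n)" "a_1k q r k \<in> carrier (free_alg n)"
    using b_k1_closed b_1k_closed a_k1_closed a_1k_closed
    by (auto simp: n intro!: reindex_closed[OF s])
  have id: "product_ev n (reindex id ?s) = product_ev n ?s"
    by (simp add: P.ev_reindex)
  show ?thesis
    unfolding k
    using P.sym_recursions[OF n] closed sym_closed(1)[of q r n]
    by (simp add: symmetrizer_eq[of n] embed shift cls_mult cls_scale free_alg_closed
        cls_eq_iff_ev id)
qed

end
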